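(* Let $Q$ be a smooth manifold and $h\in C^\infty(T^*Q\times\mathbb R\times\mathbb R)$ a (possibly time-dependent) contact Hamiltonian, with associated 1-form $\eta^E$ and time-dependent contact Hamiltonian vector field $X_h^t$ on the extended contact phase space. Let $Y\in\mathfrak X(T^*Q\times\mathbb R\times\mathbb R)$ be a generalized Noether symmetry. Then $F:=-\iota_Y\eta^E$ is a dissipated quantity, i.e. $\mathfrak L_{X_h^t}F=-R(h)\,F$.
   Context: Everything is smooth; $\mathfrak L$ denotes the Lie derivative and $\iota$ the interior product. Let $Q$ be a manifold, $\alpha$ the Liouville 1-form on $T^*Q$ (locally $\alpha=p_a dq^a$, summation over repeated indices). The contact phase space is $T^*Q\times\mathbb R$ with contact form $\eta=dS-\alpha$ (pullback understood), $S$ the coordinate on $\mathbb R$; its Reeb vector field is $R=\partial_S$. The extended contact phase space is $T^*Q\times\mathbb R\times\mathbb R$, with $t$ the coordinate on the last factor, endowed with the 1-form $\eta^E=\eta+h\,dt$ (pullback of $\eta$ understood), where $h$ is a smooth function of $(q,p,S,t)$. Here $R(h)=\partial h/\partial S$. For a smooth function $F$ of $(q,p,S,t)$, the contact Hamiltonian vector field $X_F$ is the vector field with no $\partial_t$ component whose restriction to each slice $t=\text{const}$ is determined by $\iota_{X_F}d\eta=dF-R(F)\eta$ and $\iota_{X_F}\eta=-F$ on $T^*Q\times\mathbb R$; in coordinates $X_F=\frac{\partial F}{\partial p_a}\partial_{q^a}-\left(\frac{\partial F}{\partial q^a}+p_a\frac{\partial F}{\partial S}\right)\partial_{p_a}+\left(p_a\frac{\partial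 F}{\partial p_a}-F\right)\partial_S$. The time-dependent contact Hamiltonian vector field of $h$ is $X_h^t=X_h+\partial_t$; it satisfies $\iota_{X_h^t}d\eta^E=-R(h)\eta^E$ and $\iota_{X_h^t}\eta^E=0$. A generalized Noether symmetry is a vector field $Y$ on $T^*Q\times\mathbb R\times\mathbb R$ with $\mathfrak L_Y\eta^E=\lambda\,\eta^E$ for some $\lambda\in C^\infty(T^*Q\times\mathbb R\times\mathbb R)$. A dissipated quantity is a function $F:T^*Q\times\mathbb R\times\mathbb R\to\mathbb R$ with $\mathfrak L_{X_h^t}F=-R(h)F$. *)

theory Defs
  imports "HOL-Analysis.Analysis"
begin

section \<open>Smooth maps between Euclidean spaces\<close>

text \<open>Infinite differentiability on an open set \<open>S\<close>: \<open>f\<close> is (Frechet) differentiable on \<open>S\<close>, and so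
  is each of its iterated directional derivatives. The definition has to be coinductive; in finite
  dimension it describes the class of \<open>C\<^sup>\<infinity>\<close> maps.\<close>

coinductive smooth_on :: "'a::euclidean_space set \<Rightarrow> ('a \<Rightarrow> 'b::euclidean_space) \<Rightarrow> bool"
  for S where
  "\<lbrakk>open S; \<forall>x\<in>S. f differentiable (at x);
    \<forall>v. smooth_on S (\<lambda>x. frechet_derivative f (at x) v)\<rbrakk> \<Longrightarrow> smooth_on S f"


section \<open>Smooth manifolds\<close>

text \<open>A chart is a pair of its domain and its coordinate map; only the values of the coordinate map
  on the domain matter. A smooth structure is given by an atlas.\<close>

type_synonym ('m, 'e) chart = "'m set \<times> ('m \<Rightarrow> 'e)"
type_synonym ('m, 'e) atlas = "('m, 'e) chart set"

definition smooth_manifold :: "'m topology \<Rightarrow> ('m, 'e::euclidean_space) atlas \<Rightarrow> bool" where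
  "smooth_manifold T A \<longleftrightarrow>
     Hausdorff_space T \<and> second_countable T \<and>
     (\<Union>(U, \<phi>)\<in>A. U) = topspace T \<and>
     (\<forall>(U, \<phi>)\<in>A. openin T U \<and> open (\<phi> ` U) \<and>
        homeomorphic_map (subtopology T U) (top_of_set (\<phi> ` U)) \<phi>) \<and>
     (\<forall>(U, \<phi>)\<in>A. \<forall>(V, \<psi>)\<in>A. smooth_on (\<phi> ` (U \<inter> V)) (\<psi> \<circ> inv_into U \<phi>))"

definition points :: "('m, 'e) atlas \<Rightarrow> 'm set" where
  "points A = (\<Union>(U, \<phi>)\<in>A. U)"

definition smooth_near :: "('m, 'e::euclidean_space) atlas \<Rightarrow> ('m \<Rightarrow> real) \<Rightarrow> 'm \<Rightarrow> bool" where
  "smooth_near A f x \<longleftrightarrow>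
     (\<forall>(U, \<phi>)\<in>A. x \<in> U \<longrightarrow>
        (\<exists>S. \<phi> x \<in> S \<and> S \<subseteq> \<phi> ` U \<and> smooth_on S (f \<circ> inv_into U \<phi>)))"

definition smooth_function :: "('m, 'e::euclidean_space) atlas \<Rightarrow> ('m \<Rightarrow> real) \<Rightarrow> bool" where
  "smooth_function A f \<longleftrightarrow> (\<forall>x\<in>points A. smooth_near A f x)"


section \<open>Vector fields and differential forms\<close>

text \<open>A tangent vector at \<open>x\<close> is the directional derivative operator that it induces on the functions
  that are smooth in a neighbourhood of \<open>x\<close>. On all other functions it is set to \<open>0\<close>, so that two
  tangent vectors are equal iff they agree on functions smooth near \<open>x\<close>.\<close>

type_synonym 'm tangent = "('m \<Rightarrow> real) \<Rightarrow> real"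
type_synonym 'm vector_field = "'m \<Rightarrow> 'm tangent"
type_synonym 'm one_form = "'m \<Rightarrow> 'm tangent \<Rightarrow> real"

text \<open>The tangent vector at \<open>x\<close> whose components in the given chart are those of \<open>w\<close>; for the
  basis vectors \<open>w\<close> these are the partial derivatives with respect to the coordinates.\<close>

definition coordinate_vector ::
    "('m, 'e::euclidean_space) atlas \<Rightarrow> ('m, 'e) chart \<Rightarrow> 'm \<Rightarrow> 'e \<Rightarrow> 'm tangent" where
  "coordinate_vector A = (\<lambda>(U, \<phi>) x w f.
     if smooth_near A f x then frechet_derivative (f \<circ> inv_into U \<phi>) (at (\<phi> x)) w else 0)"

definition tangent_space :: "('m, 'e::euclidean_space) atlas \<Rightarrow> 'm \<Rightarrow> 'm tangent set" where
  "tangent_space A x = {coordinate_vector A c x w | c w. c \<in> A \<and> x \<in> fst c}"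

definition smooth_vector_field ::
    "('m, 'e::euclidean_space) atlas \<Rightarrow> 'm vector_field \<Rightarrow> bool" where
  "smooth_vector_field A X \<longleftrightarrow>
     (\<forall>x\<in>points A. X x \<in> tangent_space A x \<and>
        (\<forall>f. smooth_near A f x \<longrightarrow> smooth_near A (\<lambda>y. X y f) x))"

definition lie_bracket ::
    "('m, 'e::euclidean_space) atlas \<Rightarrow> 'm vector_field \<Rightarrow> 'm vector_field \<Rightarrow> 'm vector_field" where
  "lie_bracket A X Y x f =
     (if smooth_near A f x then X x (\<lambda>y. Y y f) - Y x (\<lambda>y. X y f) else 0)"

definition pushforward :: "('m \<Rightarrow> 'k) \<Rightarrow> 'm tangent \<Rightarrow> 'k tangent" where
  "pushforward g v = (\<lambda>f. v (f \<circ> g))"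

definition pullback :: "('m \<Rightarrow> 'k) \<Rightarrow> 'k one_form \<Rightarrow> 'm one_form" where
  "pullback g \<omega> x v = \<omega> (g x) (pushforward g v)"

definition differential :: "('m \<Rightarrow> real) \<Rightarrow> 'm one_form" where
  "differential f x v = v f"

definition interior_product :: "'m vector_field \<Rightarrow> 'm one_form \<Rightarrow> 'm \<Rightarrow> real" where
  "interior_product X \<omega> x = \<omega> x (X x)"

definition lie_function :: "'m vector_field \<Rightarrow> ('m \<Rightarrow> real) \<Rightarrow> 'm \<Rightarrow> real" where
  "lie_function X f x = X x f"

text \<open>The exterior derivative \<open>d\<omega>\<close> and the Lie derivative \<open>L\<^sub>Y\<omega>\<close> of a 1-form are given
  as function-valued multilinear maps on vector fields. The former is given by Koszul's formula
  (normalised so that \<open>d(p dq) = dp \<and> dq\<close> with \<open>(dp \<and> dq)(X, Z) = dp(X) dq(Z) - dp(Z) dq(X)\<close>), and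
  the latter by the requirement that \<open>L\<^sub>Y\<close> is a derivation that commutes with contractions, acts on
  functions as \<open>Y\<close> and on vector fields as the Lie bracket with \<open>Y\<close>.\<close>

definition exterior_derivative ::
    "('m, 'e::euclidean_space) atlas \<Rightarrow> 'm one_form \<Rightarrow> 'm vector_field \<Rightarrow> 'm vector_field \<Rightarrow> 'm \<Rightarrow> real"
  where
  "exterior_derivative A \<omega> X Z x =
     lie_function X (interior_product Z \<omega>) x - lie_function Z (interior_product X \<omega>) x
       - interior_product (lie_bracket A X Z) \<omega> x"

definition lie_one_form ::
    "('m, 'e::euclidean_space) atlas \<Rightarrow> 'm vector_field \<Rightarrow> 'm one_form \<Rightarrow> 'm vector_field \<Rightarrow> 'm \<Rightarrow> real"
  where
  "lie_one_form A Y \<omega> Z x =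
     lie_function Y (interior_product Z \<omega>) x - interior_product (lie_bracket A Y Z) \<omega> x"


section \<open>The cotangent bundle and the product with the real line\<close>

type_synonym 'm cotangent = "'m tangent \<Rightarrow> real"

text \<open>Linear forms on the tangent space, set to \<open>0\<close> outside of it.\<close>

definition cotangent_space :: "('m, 'e::euclidean_space) atlas \<Rightarrow> 'm \<Rightarrow> 'm cotangent set" where
  "cotangent_space A x = {p.
     (\<forall>u\<in>tangent_space A x. \<forall>v\<in>tangent_space A x. \<forall>a b.
        p (\<lambda>f. a * u f + b * v f) = a * p u + b * p v) \<and>
     (\<forall>v. v \<notin> tangent_space A x \<longrightarrow> p v = 0)}"

text \<open>The charts \<open>(q, p)\<close> induced on the cotangent bundle: the momenta \<open>p\<^sub>b\<close> are the values of the
  covector on the coordinate vectors.\<close>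

definition cotangent_chart ::
    "('m, 'e::euclidean_space) atlas \<Rightarrow> ('m, 'e) chart \<Rightarrow> ('m \<times> 'm cotangent, 'e \<times> 'e) chart" where
  "cotangent_chart A = (\<lambda>(U, \<phi>).
     (Sigma U (cotangent_space A),
      \<lambda>(x, p). (\<phi> x, \<Sum>b\<in>Basis. p (coordinate_vector A (U, \<phi>) x b) *\<^sub>R b)))"

definition cotangent_bundle ::
    "('m, 'e::euclidean_space) atlas \<Rightarrow> ('m \<times> 'm cotangent, 'e \<times> 'e) atlas" where
  "cotangent_bundle A = cotangent_chart A ` A"

definition times_line :: "('m, 'e::euclidean_space) atlas \<Rightarrow> ('m \<times> real, 'e \<times> real) atlas" where
  "times_line A = (\<lambda>(U, \<phi>). (U \<times> UNIV, map_prod \<phi> id)) ` A"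

text \<open>The coordinate vector field of the last factor of a product with the real line.\<close>

definition line_field :: "('m \<times> real, 'e::euclidean_space) atlas \<Rightarrow> ('m \<times> real) vector_field" where
  "line_field A = (\<lambda>(x, s) f.
     if smooth_near A f (x, s) then deriv (\<lambda>r. f (x, r)) s else 0)"

definition liouville_form :: "('m \<times> 'm cotangent) one_form" where
  "liouville_form = (\<lambda>(x, p) v. p (pushforward fst v))"


section \<open>Contact phase spaces\<close>

type_synonym 'm contact_point = "('m \<times> 'm cotangent) \<times> real"
type_synonym 'm extended_point = "'m contact_point \<times> real"

abbreviation contact_phase_space ::
    "('m, 'e::euclidean_space) atlas \<Rightarrow> ('m contact_point, ('e \<times> 'e) \<times> real) atlas" where
  "contact_phase_space A \<equiv> times_line (cotangent_bundle A)"

abbreviation extended_phase_space ::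
    "('m, 'e::euclidean_space) atlas \<Rightarrow> ('m extended_point, (('e \<times> 'e) \<times> real) \<times> real) atlas" where
  "extended_phase_space A \<equiv> times_line (contact_phase_space A)"

definition contact_form :: "'m contact_point one_form" where
  "contact_form x v = differential snd x v - pullback fst liouville_form x v"

definition reeb_field :: "('m, 'e::euclidean_space) atlas \<Rightarrow> 'm contact_point vector_field" where
  "reeb_field A = line_field (contact_phase_space A)"

definition extended_contact_form :: "('m extended_point \<Rightarrow> real) \<Rightarrow> 'm extended_point one_form" where
  "extended_contact_form h x v = pullback fst contact_form x v + h x * differential snd x v"

text \<open>\<open>R(F)\<close> for a function \<open>F\<close> on the extended phase space, i.e. the partial derivative of \<open>F\<close> with
  respect to the coordinate on the first real line.\<close>

definition reeb_derivative ::
    "('m, 'e::euclidean_space) atlas \<Rightarrow> ('m extended_point \<Rightarrow> real) \<Rightarrow> 'm extended_point \<Rightarrow> real" where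
  "reeb_derivative A F = (\<lambda>(x, t). lie_function (reeb_field A) (\<lambda>y. F (y, t)) x)"

text \<open>For a field without component along the time line, this is its restriction to the slice with
  time \<open>t\<close>, regarded as a vector field on the contact phase space.\<close>

definition slice_field :: "real \<Rightarrow> ('m \<times> real) vector_field \<Rightarrow> 'm vector_field" where
  "slice_field t X x = pushforward fst (X (x, t))"

definition contact_hamiltonian_vector_field ::
    "('m, 'e::euclidean_space) atlas \<Rightarrow> ('m extended_point \<Rightarrow> real) \<Rightarrow> 'm extended_point vector_field
      \<Rightarrow> bool" where
  "contact_hamiltonian_vector_field A F X \<longleftrightarrow>
     smooth_vector_field (extended_phase_space A) X \<and>
     (\<forall>x\<in>points (extended_phase_space A). differential snd x (X x) = 0) \<and>
     (\<forall>t. \<forall>x\<in>points (contact_phase_space A).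
        (\<forall>Z. smooth_vector_field (contact_phase_space A) Z \<longrightarrow>
           exterior_derivative (contact_phase_space A) contact_form (slice_field t X) Z x =
             interior_product Z (differential (\<lambda>y. F (y, t))) x
               - lie_function (reeb_field A) (\<lambda>y. F (y, t)) x * interior_product Z contact_form x) \<and>
        interior_product (slice_field t X) contact_form x = - F (x, t))"

definition time_dependent_field ::
    "('m, 'e::euclidean_space) atlas \<Rightarrow> 'm extended_point vector_field \<Rightarrow> 'm extended_point vector_field"
  where
  "time_dependent_field A X x f = X x f + line_field (extended_phase_space A) x f"

definition generalized_noether_symmetry ::
    "('m, 'e::euclidean_space) atlas \<Rightarrow> ('m extended_point \<Rightarrow> real) \<Rightarrow> 'm extended_point vector_field
      \<Rightarrow> bool" where
  "generalized_noether_symmetry A h Y \<longleftrightarrow>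
     smooth_vector_field (extended_phase_space A) Y \<and>
     (\<exists>l. smooth_function (extended_phase_space A) l \<and>
        (\<forall>Z. smooth_vector_field (extended_phase_space A) Z \<longrightarrow>
           (\<forall>x\<in>points (extended_phase_space A).
              lie_one_form (extended_phase_space A) Y (extended_contact_form h) Z x =
                l x * interior_product Z (extended_contact_form h) x)))"

text \<open>Here \<open>X\<close> stands for the contact Hamiltonian vector field of \<open>h\<close>.\<close>

definition dissipated_quantity ::
    "('m, 'e::euclidean_space) atlas \<Rightarrow> ('m extended_point \<Rightarrow> real) \<Rightarrow> 'm extended_point vector_field
      \<Rightarrow> ('m extended_point \<Rightarrow> real) \<Rightarrow> bool" where
  "dissipated_quantity A h X F \<longleftrightarrow>
     smooth_function (extended_phase_space A) F \<and>
     (\<forall>x\<in>points (extended_phase_space A).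
        lie_function (time_dependent_field A X) F x = - reeb_derivative A h x * F x)"

end

theory Submission
  imports Defs
begin

text \<open>Put \<open>\<eta>\<^sup>E = \<eta> + h dt\<close> and \<open>W = X + \<partial>\<^sub>t\<close>. Since \<open>\<eta>\<^sup>E(W) = 0\<close>, evaluating the symmetry condition on \<open>W\<close>
  gives \<open>\<eta>\<^sup>E([Y, W]) = 0\<close>, hence \<open>W(\<eta>\<^sup>E(Y)) = d\<eta>\<^sup>E(W, Y)\<close> by Koszul's formula. Locally
  \<open>\<eta>\<^sup>E = \<Sum> f dg + h dt\<close> with \<open>f\<close>, \<open>g\<close> independent of \<open>t\<close>, so \<open>d\<eta>\<^sup>E(W, Y)\<close> is
  \<open>d\<eta>(X\<^sub>t, Y\<^sub>t) + W(h) Y(t) - Y(h) W(t)\<close> with \<open>X\<^sub>t\<close>, \<open>Y\<^sub>t\<close> the projections to the time slice. The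
  defining equation of \<open>X\<close>, applied to the test fields \<open>Y\<^sub>t\<close> and \<open>X\<^sub>t\<close>, turns this into
  \<open>- R(h) \<eta>\<^sup>E(Y)\<close>. No extension of tangent vectors to global test fields is needed.

  Cotangent vectors vanish by convention on operators that are not tangent vectors, so it is essential
  that Lie brackets of smooth fields are again tangent; this rests on the symmetry of second
  derivatives.\<close>

section \<open>Calculus of smooth maps\<close>

text \<open>The last cancellation comes from testing the equation of \<open>X\<close> on its own
  slice: \<open>d\<eta>(X\<^sub>t, X\<^sub>t) = 0\<close> forces
  \<open>X\<^sub>t(h) = R(h) \<eta>(X\<^sub>t) = - R(h) h\<close>. So
  \<open>W(h) = - R(h) h + \<partial>\<^sub>t h\<close>, while
  \<open>Y(h) = Y\<^sub>t(h) + Y(t) \<partial>\<^sub>t h\<close>; in the sum the terms with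
  \<open>Y\<^sub>t(h)\<close> and \<open>\<partial>\<^sub>t h\<close> cancel and
  \<open>- R(h) (\<eta>(Y\<^sub>t) + h Y(t))\<close> is left.

  The encoding shapes the rest. By its type a 1-form is an arbitrary function of arbitrary
  operators, so linearity and smoothness have to be read off local expressions. A tangent vector is
  0 on functions that are not smooth near its point, so smoothness must be transported along
  projections in both directions before a pushed-forward vector is known to be tangent. The extended
  phase space arises from \<open>Q\<close> by one cotangent bundle and two products with the line;
  each step is a \<open>fibration\<close> over the previous one, and one theory of projections
  serves all three.\<close>

lemma frechet_derivative_cong_open:
  assumes "open S" "x \<in> S" "\<And>y. y \<in> S \<Longrightarrow> f y = g y"
  shows "frechet_derivative f (at x) = frechet_derivative g (at x)"
proof -
  have "(f has_derivative D) (at x) \<longleftrightarrow> (g has_derivative D) (at x)" for D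
    using has_derivative_transform_within_open[OF _ assms(1,2), of f D UNIV g]
      has_derivative_transform_within_open[OF _ assms(1,2), of g D UNIV f] assms(3) by auto
  then show ?thesis unfolding frechet_derivative_def by simp
qed

lemma differentiable_cong_open:
  assumes "open S" "x \<in> S" "\<And>y. y \<in> S \<Longrightarrow> f y = g y" "f differentiable (at x)"
  shows "g differentiable (at x)"
proof -
  obtain D where "(f has_derivative D) (at x)" using assms(4) unfolding differentiable_def by blast
  then have "(g has_derivative D) (at x)"
    using assms(1-3) by (rule has_derivative_transform_within_open)
  then show ?thesis by (rule differentiableI)
qed

lemma has_frechet_derivative:
  "f differentiable (at x) \<Longrightarrow> (f has_derivative frechet_derivative f (at x)) (at x)"
  using frechet_derivative_works by blast

section \<open>Smoothness of finite order and its closure properties\<close>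

text \<open>Finite approximations of the coinductive \<open>smooth_on\<close>. The derivative of a
  product or a composite is a sum of products, which leaves the shape that a coinduction would have
  to preserve; induction on the order has no such difficulty.\<close>

primrec n_smooth_on ::
    "nat \<Rightarrow> 'a::euclidean_space set \<Rightarrow> ('a \<Rightarrow> 'b::euclidean_space) \<Rightarrow> bool" where
  "n_smooth_on 0 S f = open S"
| "n_smooth_on (Suc n) S f = (open S \<and> (\<forall>x\<in>S. f differentiable (at x)) \<and>
     (\<forall>v. n_smooth_on n S (\<lambda>x. frechet_derivative f (at x) v)))"

text \<open>The property "of every finite order" is itself a coinduction invariant: order
  \<open>Suc n\<close> of \<open>f\<close> gives order \<open>n\<close> of each directional
  derivative.\<close>

lemma smooth_on_iff_n_smooth_on: "smooth_on S f \<longleftrightarrow> (\<forall>n. n_smooth_on n S f)"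
proof
  assume "smooth_on S f"
  then have "n_smooth_on n S f" for n
  proof (induction n arbitrary: f)
    case 0
    then show ?case by (auto elim: smooth_on.cases)
  next
    case (Suc n)
    from Suc.prems show ?case
      by (cases rule: smooth_on.cases) (auto intro: Suc.IH)
  qed
  then show "\<forall>n. n_smooth_on n S f" by blast
next
  assume "\<forall>n. n_smooth_on n S f"
  then show "smooth_on S f"
  proof (coinduction arbitrary: f)
    case smooth_on
    then have "n_smooth_on (Suc n) S f" for n by blast
    then show ?case by auto
  qed
qed

lemma n_smooth_on_cong:
  assumes "n_smooth_on n S f" "\<And>x. x \<in> S \<Longrightarrow> f x = g x"
  shows "n_smooth_on n S g"
  using assms
proof (induction n arbitrary: f g)
  case (Suc n)
  then have S: "open S" by simp
  have "g differentiable (at x)" if "x \<in> S" for x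
    using differentiable_cong_open[OF S that, of f g] Suc.prems that by auto
  moreover have "n_smooth_on n S (\<lambda>x. frechet_derivative g (at x) v)" for v
  proof (rule Suc.IH)
    show "n_smooth_on n S (\<lambda>x. frechet_derivative f (at x) v)" using Suc.prems by simp
    show "frechet_derivative f (at x) v = frechet_derivative g (at x) v" if "x \<in> S" for x
      using frechet_derivative_cong_open[OF S that, of f g] Suc.prems by simp
  qed
  ultimately show ?case using S by simp
qed simp

lemma n_smooth_on_subset:
  "n_smooth_on n S f \<Longrightarrow> open S' \<Longrightarrow> S' \<subseteq> S \<Longrightarrow> n_smooth_on n S' f"
  by (induction n arbitrary: f) auto

text \<open>Lets the closure lemmas work with a derivative \<open>D\<close> computed by the usual
  rules instead of the chosen \<open>frechet_derivative\<close>.\<close>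

lemma n_smooth_on_Suc:
  assumes "open S" "\<And>x. x \<in> S \<Longrightarrow> (f has_derivative D x) (at x)"
    and "\<And>v. n_smooth_on n S (\<lambda>x. D x v)"
  shows "n_smooth_on (Suc n) S f"
proof -
  have "frechet_derivative f (at x) = D x" if "x \<in> S" for x
    using assms(2)[OF that] frechet_derivative_at by metis
  then have "n_smooth_on n S (\<lambda>x. frechet_derivative f (at x) v)" for v
    using n_smooth_on_cong[OF assms(3), of v "\<lambda>x. frechet_derivative f (at x) v"] by simp
  then show ?thesis using assms(1,2) by (auto simp: differentiable_def)
qed

lemma n_smooth_on_SucD: "n_smooth_on (Suc n) S f \<Longrightarrow> n_smooth_on n S f"
  by (induction n arbitrary: f) auto

lemma n_smooth_on_const: "open S \<Longrightarrow> n_smooth_on n S (\<lambda>x. c)"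
  by (induction n arbitrary: c) auto

lemma n_smooth_on_linear:
  assumes "bounded_linear L" "n_smooth_on n S f"
  shows "n_smooth_on n S (\<lambda>x. L (f x))"
  using assms(2)
proof (induction n arbitrary: f)
  case (Suc n)
  show ?case
    by (rule n_smooth_on_Suc[where D = "\<lambda>x v. L (frechet_derivative f (at x) v)"])
       (use Suc in \<open>auto intro!: bounded_linear.has_derivative[OF assms(1)] has_frechet_derivative\<close>)
qed simp

lemma n_smooth_on_add:
  assumes "n_smooth_on n S f" "n_smooth_on n S g"
  shows "n_smooth_on n S (\<lambda>x. f x + g x)"
  using assms
proof (induction n arbitrary: f g)
  case (Suc n)
  show ?case
    by (rule n_smooth_on_Suc
        [where D = "\<lambda>x v. frechet_derivative f (at x) v + frechet_derivative g (at x) v"])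
       (use Suc in \<open>auto intro!: has_derivative_add has_frechet_derivative\<close>)
qed simp

lemma n_smooth_on_sum:
  assumes "open S" "\<And>i. i \<in> I \<Longrightarrow> n_smooth_on n S (f i)"
  shows "n_smooth_on n S (\<lambda>x. \<Sum>i\<in>I. f i x)"
  using assms(2)
  by (induction I rule: infinite_finite_induct)
     (auto simp: n_smooth_on_const assms(1) intro: n_smooth_on_add)

lemma n_smooth_on_scaleR:
  assumes "n_smooth_on n S f" "n_smooth_on n S g"
  shows "n_smooth_on n S (\<lambda>x. f x *\<^sub>R g x)"
  using assms
proof (induction n arbitrary: f g)
  case (Suc n)
  \<comment> \<open>The product rule keeps the undifferentiated factors \<open>f\<close> and
    \<open>g\<close>; the induction hypothesis needs them at the lower order.\<close>
  note SucD = Suc.prems[THEN n_smooth_on_SucD]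
  show ?case
  proof (rule n_smooth_on_Suc
      [where D = "\<lambda>x v. f x *\<^sub>R frechet_derivative g (at x) v + frechet_derivative f (at x) v *\<^sub>R g x"])
    show "open S" using Suc.prems by simp
    show "((\<lambda>x. f x *\<^sub>R g x) has_derivative
        (\<lambda>v. f x *\<^sub>R frechet_derivative g (at x) v + frechet_derivative f (at x) v *\<^sub>R g x)) (at x)"
      if "x \<in> S" for x
      using Suc.prems that by (auto intro!: has_derivative_scaleR has_frechet_derivative)
    show "n_smooth_on n S
        (\<lambda>x. f x *\<^sub>R frechet_derivative g (at x) v + frechet_derivative f (at x) v *\<^sub>R g x)" for v
      using Suc.prems SucD by (intro n_smooth_on_add Suc.IH) auto
  qed
qed simp

lemma n_smooth_on_compose:
  fixes f :: "'a::euclidean_space \<Rightarrow> 'b::euclidean_space" and g :: "'b \<Rightarrow> 'c::euclidean_space"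
  assumes "n_smooth_on n S f" "n_smooth_on n S' g" "f ` S \<subseteq> S'"
  shows "n_smooth_on n S (\<lambda>x. g (f x))"
  using assms
proof (induction n arbitrary: g)
  case (Suc n)
  have f: "n_smooth_on n S f" using Suc.prems n_smooth_on_SucD by blast
  have S: "open S" using Suc.prems by simp
  \<comment> \<open>In the chain rule the direction \<open>frechet_derivative f (at x) v\<close>
    varies with \<open>x\<close>, whereas the induction hypothesis covers derivatives of
    \<open>g\<close> in fixed directions. Expanding in the basis makes the directions constant and
    moves the dependence on \<open>x\<close> into scalar factors.\<close>
  define D where "D x v = (\<Sum>b\<in>Basis. (frechet_derivative f (at x) v \<bullet> b) *\<^sub>R
    frechet_derivative g (at (f x)) b)" for x v
  show ?case
  proof (rule n_smooth_on_Suc[where D = D])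
    show "open S" by fact
    fix x assume x: "x \<in> S"
    then have g: "(g has_derivative frechet_derivative g (at (f x))) (at (f x))"
      using Suc.prems by (auto intro!: has_frechet_derivative)
    have f: "(f has_derivative frechet_derivative f (at x)) (at x)"
      using Suc.prems x by (auto intro!: has_frechet_derivative)
    have "frechet_derivative g (at (f x)) w = (\<Sum>b\<in>Basis. (w \<bullet> b) *\<^sub>R frechet_derivative g (at (f x)) b)" for w
    proof -
      have lin: "linear (frechet_derivative g (at (f x)))" using g has_derivative_linear by blast
      have "frechet_derivative g (at (f x)) w = frechet_derivative g (at (f x)) (\<Sum>b\<in>Basis. (w \<bullet> b) *\<^sub>R b)"
        by (simp add: euclidean_representation)
      also have "\<dots> = (\<Sum>b\<in>Basis. (w \<bullet> b) *\<^sub>R frechet_derivative g (at (f x)) b)"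
        using lin by (simp add: linear_sum linear_cmul)
      finally show ?thesis .
    qed
    then have "D x v = frechet_derivative g (at (f x)) (frechet_derivative f (at x) v)" for v
      unfolding D_def by (rule sym)
    then have "D x = frechet_derivative g (at (f x)) \<circ> frechet_derivative f (at x)"
      by (intro ext) (simp only: o_def)
    then show "((\<lambda>x. g (f x)) has_derivative D x) (at x)"
      using diff_chain_at[OF f g] by (simp add: o_def)
  next
    fix v
    have "n_smooth_on n S (\<lambda>x. frechet_derivative f (at x) v \<bullet> b)" for b
      using Suc.prems by (intro n_smooth_on_linear[OF bounded_linear_inner_left]) simp
    moreover have "n_smooth_on n S (\<lambda>x. frechet_derivative g (at (f x)) b)" for b
      using Suc.prems by (intro Suc.IH[of "\<lambda>y. frechet_derivative g (at y) b"] f) auto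
    ultimately show "n_smooth_on n S (\<lambda>x. D x v)"
      unfolding D_def by (intro n_smooth_on_sum S n_smooth_on_scaleR)
  qed
qed simp

lemma n_smooth_on_ident: "open S \<Longrightarrow> n_smooth_on n S (\<lambda>x. x)"
  by (induction n) (auto intro: n_smooth_on_const)

lemma smooth_on_open: "smooth_on S f \<Longrightarrow> open S"
  by (auto elim: smooth_on.cases)

lemma smooth_on_differentiable: "smooth_on S f \<Longrightarrow> x \<in> S \<Longrightarrow> f differentiable (at x)"
  by (auto elim: smooth_on.cases)

lemma smooth_on_has_derivative:
  "smooth_on S f \<Longrightarrow> x \<in> S \<Longrightarrow> (f has_derivative frechet_derivative f (at x)) (at x)"
  by (intro has_frechet_derivative smooth_on_differentiable)

lemma smooth_on_derivative: "smooth_on S f \<Longrightarrow> smooth_on S (\<lambda>x. frechet_derivative f (at x) v)"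
  by (auto elim: smooth_on.cases)

lemma smooth_on_continuous: "smooth_on S f \<Longrightarrow> continuous_on S f"
  by (simp add: continuous_at_imp_continuous_on differentiable_imp_continuous_within
      smooth_on_differentiable)

lemma smooth_on_cong: "smooth_on S f \<Longrightarrow> (\<And>x. x \<in> S \<Longrightarrow> f x = g x) \<Longrightarrow> smooth_on S g"
  unfolding smooth_on_iff_n_smooth_on by (auto intro: n_smooth_on_cong)

lemma smooth_on_subset: "smooth_on S f \<Longrightarrow> open S' \<Longrightarrow> S' \<subseteq> S \<Longrightarrow> smooth_on S' f"
  unfolding smooth_on_iff_n_smooth_on by (auto intro: n_smooth_on_subset)

lemma smooth_on_const: "open S \<Longrightarrow> smooth_on S (\<lambda>x. c)"
  by (simp add: smooth_on_iff_n_smooth_on n_smooth_on_const)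

lemma smooth_on_ident: "open S \<Longrightarrow> smooth_on S (\<lambda>x. x)"
  by (simp add: smooth_on_iff_n_smooth_on n_smooth_on_ident)

lemma smooth_on_linear: "bounded_linear L \<Longrightarrow> smooth_on S f \<Longrightarrow> smooth_on S (\<lambda>x. L (f x))"
  by (simp add: smooth_on_iff_n_smooth_on n_smooth_on_linear)

lemma smooth_on_add: "smooth_on S f \<Longrightarrow> smooth_on S g \<Longrightarrow> smooth_on S (\<lambda>x. f x + g x)"
  by (simp add: smooth_on_iff_n_smooth_on n_smooth_on_add)

lemma smooth_on_sum:
  "open S \<Longrightarrow> (\<And>i. i \<in> I \<Longrightarrow> smooth_on S (f i)) \<Longrightarrow> smooth_on S (\<lambda>x. \<Sum>i\<in>I. f i x)"
  by (simp add: smooth_on_iff_n_smooth_on n_smooth_on_sum)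

lemma smooth_on_scaleR: "smooth_on S f \<Longrightarrow> smooth_on S g \<Longrightarrow> smooth_on S (\<lambda>x. f x *\<^sub>R g x)"
  by (simp add: smooth_on_iff_n_smooth_on n_smooth_on_scaleR)

lemma smooth_on_mult:
  "smooth_on S f \<Longrightarrow> smooth_on S g \<Longrightarrow> smooth_on S (\<lambda>x. f x * g x :: real)"
  using smooth_on_scaleR[of S f g] by simp

lemma smooth_on_inner:
  fixes f g :: "'x::euclidean_space \<Rightarrow> 'y::euclidean_space"
  assumes f: "smooth_on S f" and g: "smooth_on S g"
  shows "smooth_on S (\<lambda>x. f x \<bullet> g x)"
proof -
  have "smooth_on S (\<lambda>x. \<Sum>b\<in>Basis. (f x \<bullet> b) * (g x \<bullet> b))"
    by (rule smooth_on_sum[OF smooth_on_open[OF f]])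
      (rule smooth_on_mult[OF smooth_on_linear[OF bounded_linear_inner_left f]
          smooth_on_linear[OF bounded_linear_inner_left g]])
  then show ?thesis by (rule smooth_on_cong) (rule euclidean_inner[symmetric])
qed

lemma smooth_on_compose:
  "smooth_on S f \<Longrightarrow> smooth_on S' g \<Longrightarrow> f ` S \<subseteq> S' \<Longrightarrow> smooth_on S (\<lambda>x. g (f x))"
  unfolding smooth_on_iff_n_smooth_on by (auto intro: n_smooth_on_compose)

lemma smooth_on_Pair:
  assumes "smooth_on S f" "smooth_on S g"
  shows "smooth_on S (\<lambda>x. (f x, g x))"
proof -
  have "smooth_on S (\<lambda>x. (f x, 0) + (0, g x))"
    using assms bounded_linear_Pair[OF bounded_linear_ident bounded_linear_zero]
      bounded_linear_Pair[OF bounded_linear_zero bounded_linear_ident]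
    by (intro smooth_on_add) (rule smooth_on_linear; assumption)+
  then show ?thesis by simp
qed

section \<open>Symmetry of second derivatives\<close>

text \<open>The mean value theorem, used twice: \<open>G\<close> is the increment along
  \<open>t v\<close> as a function of the position along \<open>u\<close>, and its derivative is an
  increment of the \<open>u\<close>-derivative \<open>H\<close>, to which the theorem applies along
  \<open>v\<close>.\<close>

lemma mixed_difference_mvt:
  fixes f :: "'a::euclidean_space \<Rightarrow> real"
  assumes f: "smooth_on S f" and t: "0 < t"
    and S: "\<And>s r. 0 \<le> s \<Longrightarrow> s \<le> t \<Longrightarrow> 0 \<le> r \<Longrightarrow> r \<le> t \<Longrightarrow> x + s *\<^sub>R u + r *\<^sub>R v \<in> S"
  obtains s r where "0 \<le> s" "s \<le> t" "0 \<le> r" "r \<le> t"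
    "f (x + t *\<^sub>R u + t *\<^sub>R v) - f (x + t *\<^sub>R u) - f (x + t *\<^sub>R v) + f x =
     t * t * frechet_derivative (\<lambda>y. frechet_derivative f (at y) u) (at (x + s *\<^sub>R u + r *\<^sub>R v)) v"
proof -
  have line: "((\<lambda>s. g (a + s *\<^sub>R w)) has_real_derivative frechet_derivative g (at (a + s *\<^sub>R w)) w) (at s)"
    if "smooth_on S g" "a + s *\<^sub>R w \<in> S" for g :: "'a \<Rightarrow> real" and a w s
  proof -
    have 1: "((\<lambda>s. a + s *\<^sub>R w) has_derivative (\<lambda>s. s *\<^sub>R w)) (at s)"
      by (auto intro!: derivative_eq_intros)
    note 2 = smooth_on_has_derivative[OF that]
    have "linear (frechet_derivative g (at (a + s *\<^sub>R w)))" using 2 has_derivative_linear by blast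
    then show ?thesis
      using diff_chain_at[OF 1 2]
      unfolding has_real_derivative_iff_has_vector_derivative has_vector_derivative_def
      by (simp add: o_def linear_cmul)
  qed
  define G where "G s = f ((x + t *\<^sub>R v) + s *\<^sub>R u) - f (x + s *\<^sub>R u)" for s
  have inS: "x + t *\<^sub>R v + s *\<^sub>R u \<in> S" "x + s *\<^sub>R u \<in> S" if "0 \<le> s" "s \<le> t" for s
    using S[OF that, of t] S[OF that, of 0] t by (simp_all add: algebra_simps)
  have "\<exists>s. 0 < s \<and> s < t \<and> G t - G 0 = (t - 0) *
     (frechet_derivative f (at ((x + t *\<^sub>R v) + s *\<^sub>R u)) u - frechet_derivative f (at (x + s *\<^sub>R u)) u)"
    unfolding G_def using inS
    by (intro MVT2[OF t]) (auto intro!: DERIV_diff line[OF f])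
  then obtain s where s: "0 < s" "s < t" and Gs: "G t - G 0 = t *
     (frechet_derivative f (at ((x + t *\<^sub>R v) + s *\<^sub>R u)) u - frechet_derivative f (at (x + s *\<^sub>R u)) u)"
    by auto
  define H where "H r = frechet_derivative f (at ((x + s *\<^sub>R u) + r *\<^sub>R v)) u" for r
  have "\<exists>r. 0 < r \<and> r < t \<and> H t - H 0 = (t - 0) *
     frechet_derivative (\<lambda>y. frechet_derivative f (at y) u) (at ((x + s *\<^sub>R u) + r *\<^sub>R v)) v"
    unfolding H_def using s S
    by (intro MVT2[OF t]) (auto intro!: line[OF smooth_on_derivative[OF f]])
  then obtain r where r: "0 < r" "r < t" and Hr: "H t - H 0 = t *
     frechet_derivative (\<lambda>y. frechet_derivative f (at y) u) (at ((x + s *\<^sub>R u) + r *\<^sub>R v)) v"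
    by auto
  have "f (x + t *\<^sub>R u + t *\<^sub>R v) - f (x + t *\<^sub>R u) - f (x + t *\<^sub>R v) + f x = G t - G 0"
    by (simp add: G_def algebra_simps)
  also have "\<dots> = t * (H t - H 0)" unfolding Gs H_def by (simp add: algebra_simps)
  finally show ?thesis using Hr s r that[of s r] by (simp add: mult.assoc)
qed

text \<open>The second difference of \<open>f\<close> does not change when \<open>u\<close> and
  \<open>v\<close> are exchanged. So the two mixed derivatives coincide at a pair of points
  arbitrarily close to \<open>x\<close>, and their continuity carries this over to
  \<open>x\<close>.\<close>

lemma smooth_on_second_derivative_symmetric:
  fixes f :: "'a::euclidean_space \<Rightarrow> real"
  assumes f: "smooth_on S f" and x: "x \<in> S"
  shows "frechet_derivative (\<lambda>y. frechet_derivative f (at y) u) (at x) v =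
         frechet_derivative (\<lambda>y. frechet_derivative f (at y) v) (at x) u"
    (is "?D u v x = ?D v u x")
proof (rule ccontr)
  assume ne: "?D u v x \<noteq> ?D v u x"
  \<comment> \<open>Half the supposed gap: one common value cannot lie within \<open>e\<close> of
    both ends.\<close>
  define e where "e = \<bar>?D u v x - ?D v u x\<bar> / 2"
  have e: "e > 0" using ne by (simp add: e_def)
  have cont: "isCont (?D u v) x" for u v
    using smooth_on_differentiable[OF smooth_on_derivative[OF smooth_on_derivative[OF f]] x]
    by (rule differentiable_imp_continuous_within)
  obtain d1 where d1: "d1 > 0" "\<And>y. dist y x < d1 \<Longrightarrow> dist (?D u v y) (?D u v x) < e"
    using cont[of u v] e unfolding continuous_at_eps_delta by blast
  obtain d2 where d2: "d2 > 0" "\<And>y. dist y x < d2 \<Longrightarrow> dist (?D v u y) (?D v u x) < e"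
    using cont[of v u] e unfolding continuous_at_eps_delta by blast
  obtain d3 where d3: "d3 > 0" "ball x d3 \<subseteq> S"
    using smooth_on_open[OF f] x open_contains_ball by blast
  define d where "d = min d1 (min d2 d3)"
  \<comment> \<open>Any displacement \<open>s u + r v\<close> with \<open>s\<close>,
    \<open>r\<close> in \<open>[0, t]\<close> is then shorter than \<open>d\<close>; the summand 1
    keeps the denominator positive when \<open>u = v = 0\<close>.\<close>
  define t where "t = d / (2 * (norm u + norm v + 1))"
  have d: "d > 0" using d1 d2 d3 by (simp add: d_def)
  have pos: "norm u + norm v + 1 > 0"
    using norm_ge_zero[of u] norm_ge_zero[of v] by linarith
  have t: "t > 0" using d pos by (simp add: t_def)
  have near: "dist (x + s *\<^sub>R u + r *\<^sub>R v) x < d" if "0 \<le> s" "s \<le> t" "0 \<le> r" "r \<le> t" for s r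
  proof -
    have "dist (x + s *\<^sub>R u + r *\<^sub>R v) x = norm (s *\<^sub>R u + r *\<^sub>R v)"
      by (simp add: dist_norm algebra_simps)
    also have "\<dots> \<le> s * norm u + r * norm v"
      using norm_triangle_ineq[of "s *\<^sub>R u" "r *\<^sub>R v"] that by simp
    also have "\<dots> \<le> t * norm u + t * norm v"
      using that by (intro add_mono mult_right_mono) auto
    also have "\<dots> < 2 * (t * (norm u + norm v + 1))"
    proof -
      have "0 \<le> t * norm u" "0 \<le> t * norm v" using t by auto
      then show ?thesis using t unfolding distrib_left mult_2 by linarith
    qed
    also have "\<dots> = d" using pos by (simp add: t_def field_simps)
    finally show ?thesis .
  qed
  then have inS: "x + s *\<^sub>R u + r *\<^sub>R v \<in> S" if "0 \<le> s" "s \<le> t" "0 \<le> r" "r \<le> t" for s r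
    using d3 near[OF that] by (auto simp: d_def dist_commute)
  have inS': "x + s *\<^sub>R v + r *\<^sub>R u \<in> S" if "0 \<le> s" "s \<le> t" "0 \<le> r" "r \<le> t" for s r
    using inS[of r s] that by (simp add: algebra_simps)
  obtain s r where 1: "0 \<le> s" "s \<le> t" "0 \<le> r" "r \<le> t"
    "f (x + t *\<^sub>R u + t *\<^sub>R v) - f (x + t *\<^sub>R u) - f (x + t *\<^sub>R v) + f x =
     t * t * ?D u v (x + s *\<^sub>R u + r *\<^sub>R v)"
    using mixed_difference_mvt[where S = S, OF f t inS] by blast
  obtain s' r' where 2: "0 \<le> s'" "s' \<le> t" "0 \<le> r'" "r' \<le> t"
    "f (x + t *\<^sub>R v + t *\<^sub>R u) - f (x + t *\<^sub>R v) - f (x + t *\<^sub>R u) + f x =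
     t * t * ?D v u (x + s' *\<^sub>R v + r' *\<^sub>R u)"
    using mixed_difference_mvt[where S = S, OF f t inS'] by blast
  have "x + t *\<^sub>R v + t *\<^sub>R u = x + t *\<^sub>R u + t *\<^sub>R v" by (simp add: algebra_simps)
  note 3 = 2(5)[unfolded this]
  have "t * t * ?D u v (x + s *\<^sub>R u + r *\<^sub>R v) = t * t * ?D v u (x + s' *\<^sub>R v + r' *\<^sub>R u)"
    using 1(5) 3 by linarith
  then have "?D u v (x + s *\<^sub>R u + r *\<^sub>R v) = ?D v u (x + s' *\<^sub>R v + r' *\<^sub>R u)"
    using t by simp
  moreover have "dist (?D u v (x + s *\<^sub>R u + r *\<^sub>R v)) (?D u v x) < e"
    using near[OF 1(1-4)] by (intro d1(2)) (auto simp: d_def)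
  moreover have "dist (?D v u (x + s' *\<^sub>R v + r' *\<^sub>R u)) (?D v u x) < e"
    using near[OF 2(3,4,1,2)] by (intro d2(2)) (auto simp: d_def algebra_simps)
  moreover have "False" if "p = q" "dist p a < \<bar>a - b\<bar> / 2" "dist q b < \<bar>a - b\<bar> / 2" for p q a b :: real
    using that unfolding dist_real_def by (auto simp: abs_if split: if_splits)
  ultimately show False unfolding e_def by blast
qed

section \<open>Tangent vectors and Lie brackets\<close>

text \<open>Conditions on the atlas alone, so that they can be established again for
  \<open>cotangent_bundle A\<close> and \<open>times_line A\<close>, which are given as atlases
  without a topology.\<close>

locale smooth_atlas =
  fixes A :: "('m, 'e::euclidean_space) atlas"
  assumes inj_chart: "(U, \<phi>) \<in> A \<Longrightarrow> inj_on \<phi> U"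
    and open_chart: "(U, \<phi>) \<in> A \<Longrightarrow> open (\<phi> ` U)"
    and transition: "(U, \<phi>) \<in> A \<Longrightarrow> (V, \<psi>) \<in> A \<Longrightarrow> smooth_on (\<phi> ` (U \<inter> V)) (\<psi> \<circ> inv_into U \<phi>)"
begin

text \<open>\<open>smooth_near\<close> quantifies over all charts at the point. One chart suffices,
  because composing with the transition map on the preimage \<open>S'\<close> of \<open>S\<close>
  gives smoothness in any other.\<close>

lemma smooth_near_chartI:
  assumes U: "(U, \<phi>) \<in> A" "x \<in> U" and S: "\<phi> x \<in> S" "S \<subseteq> \<phi> ` U"
    and f: "smooth_on S (f \<circ> inv_into U \<phi>)"
  shows "smooth_near A f x"
  unfolding smooth_near_def
proof safe
  fix V \<psi> assume V: "(V, \<psi>) \<in> A" "x \<in> V"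
  define \<tau> where "\<tau> = \<phi> \<circ> inv_into V \<psi>"
  have \<tau>: "smooth_on (\<psi> ` (V \<inter> U)) \<tau>" using transition[OF V(1) U(1)] by (simp add: \<tau>_def)
  define S' where "S' = \<psi> ` (V \<inter> U) \<inter> \<tau> -` S"
  have inv: "inv_into V \<psi> (\<psi> y) = y" if "y \<in> V" for y
    using inj_chart[OF V(1)] that by simp
  have "open S'"
    unfolding S'_def using smooth_on_continuous[OF \<tau>] smooth_on_open[OF \<tau>] smooth_on_open[OF f]
    by (rule continuous_open_preimage)
  then have "smooth_on S' \<tau>" using smooth_on_subset[OF \<tau>] by (simp add: S'_def)
  then have "smooth_on S' (\<lambda>e. (f \<circ> inv_into U \<phi>) (\<tau> e))"
    by (rule smooth_on_compose[OF _ f]) (auto simp: S'_def)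
  then have "smooth_on S' (f \<circ> inv_into V \<psi>)"
    by (rule smooth_on_cong) (use inv inj_chart[OF U(1)] in \<open>auto simp: S'_def \<tau>_def\<close>)
  moreover have "\<psi> x \<in> S'" using U V S inv by (auto simp: S'_def \<tau>_def)
  moreover have "S' \<subseteq> \<psi> ` V" by (auto simp: S'_def)
  ultimately show "\<exists>S. \<psi> x \<in> S \<and> S \<subseteq> \<psi> ` V \<and> smooth_on S (f \<circ> inv_into V \<psi>)" by blast
qed

lemma smooth_near_chartE:
  assumes "smooth_near A f x" "(U, \<phi>) \<in> A" "x \<in> U"
  obtains S where "\<phi> x \<in> S" "S \<subseteq> \<phi> ` U" "smooth_on S (f \<circ> inv_into U \<phi>)"
  using assms unfolding smooth_near_def by blast

lemma inv_chart: "(U, \<phi>) \<in> A \<Longrightarrow> y \<in> U \<Longrightarrow> inv_into U \<phi> (\<phi> y) = y"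
  using inj_chart by simp

lemma smooth_near_cong:
  assumes U: "(U, \<phi>) \<in> A" "x \<in> U" and S: "open S" "\<phi> x \<in> S"
    and eq: "\<And>y. y \<in> U \<Longrightarrow> \<phi> y \<in> S \<Longrightarrow> f y = g y" and f: "smooth_near A f x"
  shows "smooth_near A g x"
proof -
  obtain S' where S': "\<phi> x \<in> S'" "S' \<subseteq> \<phi> ` U" "smooth_on S' (f \<circ> inv_into U \<phi>)"
    using smooth_near_chartE[OF f U] .
  have op: "open (S \<inter> S')" using S(1) smooth_on_open[OF S'(3)] by blast
  have "smooth_on (S \<inter> S') (g \<circ> inv_into U \<phi>)"
    by (rule smooth_on_cong[OF smooth_on_subset[OF S'(3) op]])
      (use S'(2) eq in \<open>auto simp: subset_iff inv_into_into f_inv_into_f\<close>)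
  then show ?thesis using smooth_near_chartI[OF U, of "S \<inter> S'"] S S' by blast
qed

lemma smooth_near_combine:
  assumes f: "smooth_near A f x" and g: "smooth_near A g x"
    and c: "\<And>(S :: 'e set) F G. smooth_on S F \<Longrightarrow> smooth_on S G \<Longrightarrow> smooth_on S (\<lambda>e. c (F e) (G e))"
  shows "smooth_near A (\<lambda>y. c (f y) (g y)) x"
  unfolding smooth_near_def
proof safe
  fix U \<phi> assume U: "(U, \<phi>) \<in> A" "x \<in> U"
  obtain S where S: "\<phi> x \<in> S" "S \<subseteq> \<phi> ` U" "smooth_on S (f \<circ> inv_into U \<phi>)"
    using smooth_near_chartE[OF f U] .
  obtain S' where S': "\<phi> x \<in> S'" "S' \<subseteq> \<phi> ` U" "smooth_on S' (g \<circ> inv_into U \<phi>)"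
    using smooth_near_chartE[OF g U] .
  have op: "open (S \<inter> S')" using smooth_on_open S S' by blast
  have "smooth_on (S \<inter> S') (\<lambda>e. c ((f \<circ> inv_into U \<phi>) e) ((g \<circ> inv_into U \<phi>) e))"
    using c[OF smooth_on_subset[OF S(3) op Int_lower1] smooth_on_subset[OF S'(3) op Int_lower2]] by simp
  then have "smooth_on (S \<inter> S') ((\<lambda>y. c (f y) (g y)) \<circ> inv_into U \<phi>)" by (simp add: o_def)
  then show "\<exists>S. \<phi> x \<in> S \<and> S \<subseteq> \<phi> ` U \<and> smooth_on S ((\<lambda>y. c (f y) (g y)) \<circ> inv_into U \<phi>)"
    using S S' by blast
qed

lemma smooth_near_const: "smooth_near A (\<lambda>y. c) x"
  unfolding smooth_near_def
proof safe
  fix U \<phi> assume "(U, \<phi>) \<in> A" "x \<in> U"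
  then show "\<exists>S. \<phi> x \<in> S \<and> S \<subseteq> \<phi> ` U \<and> smooth_on S ((\<lambda>y. c) \<circ> inv_into U \<phi>)"
    using smooth_on_const[OF open_chart, of U \<phi> c] by (intro exI[of _ "\<phi> ` U"]) (simp add: o_def)
qed

lemma smooth_near_add:
  "smooth_near A f x \<Longrightarrow> smooth_near A g x \<Longrightarrow> smooth_near A (\<lambda>y. f y + g y) x"
  using smooth_near_combine[of f x g "(+)"] smooth_on_add by blast

lemma smooth_near_mult:
  "smooth_near A f x \<Longrightarrow> smooth_near A g x \<Longrightarrow> smooth_near A (\<lambda>y. f y * g y) x"
  using smooth_near_combine[of f x g "(*)"] smooth_on_mult by blast

lemma smooth_near_uminus: "smooth_near A f x \<Longrightarrow> smooth_near A (\<lambda>y. - f y) x"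
  using smooth_near_mult[OF smooth_near_const[of "-1"], of f x] by simp

lemma smooth_near_sum:
  "(\<And>i. i \<in> I \<Longrightarrow> smooth_near A (f i) x) \<Longrightarrow> smooth_near A (\<lambda>y. \<Sum>i\<in>I. f i y) x"
  by (induction I rule: infinite_finite_induct) (auto intro: smooth_near_const smooth_near_add)

lemma smooth_near_sum_list:
  "(\<And>i. i \<in> set L \<Longrightarrow> smooth_near A (f i) x) \<Longrightarrow> smooth_near A (\<lambda>y. \<Sum>i\<leftarrow>L. f i y) x"
  by (induction L) (auto intro: smooth_near_const smooth_near_add)

lemma smooth_near_coordinate:
  assumes U: "(U, \<phi>) \<in> A" "x \<in> U"
  shows "smooth_near A (\<lambda>y. \<phi> y \<bullet> b) x"
proof (rule smooth_near_chartI[OF U])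
  have "smooth_on (\<phi> ` U) (\<lambda>e. e \<bullet> b)"
    using open_chart[OF U(1)] by (intro smooth_on_linear[OF bounded_linear_inner_left] smooth_on_ident)
  then show "smooth_on (\<phi> ` U) ((\<lambda>y. \<phi> y \<bullet> b) \<circ> inv_into U \<phi>)"
    by (rule smooth_on_cong) (auto simp: inv_chart[OF U(1)])
qed (use U in auto)

section \<open>Tangent vectors in coordinates\<close>

lemma coordinate_vector_smooth:
  "smooth_near A f x \<Longrightarrow>
    coordinate_vector A (U, \<phi>) x w f = frechet_derivative (f \<circ> inv_into U \<phi>) (at (\<phi> x)) w"
  by (simp add: coordinate_vector_def)

lemma coordinate_vector_not_smooth: "\<not> smooth_near A f x \<Longrightarrow> coordinate_vector A c x w f = 0"
  by (cases c) (simp add: coordinate_vector_def)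

lemma smooth_near_differentiable:
  assumes "smooth_near A f x" "(U, \<phi>) \<in> A" "x \<in> U"
  shows "(f \<circ> inv_into U \<phi>) differentiable (at (\<phi> x))"
  using smooth_near_chartE[OF assms] smooth_on_differentiable by metis

lemma coordinate_vector_in_tangent_space:
  "(U, \<phi>) \<in> A \<Longrightarrow> x \<in> U \<Longrightarrow> coordinate_vector A (U, \<phi>) x w \<in> tangent_space A x"
  unfolding tangent_space_def by fastforce

text \<open>Chain rule for the change of coordinates. It allows the chart chosen existentially in
  \<open>tangent_space\<close> to be replaced by any chart around the point.\<close>

lemma coordinate_vector_transition:
  assumes U: "(U, \<phi>) \<in> A" "x \<in> U" and V: "(V, \<psi>) \<in> A" "x \<in> V"
  shows "coordinate_vector A (V, \<psi>) x w =
    coordinate_vector A (U, \<phi>) x (frechet_derivative (\<phi> \<circ> inv_into V \<psi>) (at (\<psi> x)) w)"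
proof
  fix f
  define \<tau> where "\<tau> = \<phi> \<circ> inv_into V \<psi>"
  have \<tau>: "smooth_on (\<psi> ` (V \<inter> U)) \<tau>" using transition[OF V(1) U(1)] by (simp add: \<tau>_def)
  have \<psi>x: "\<psi> x \<in> \<psi> ` (V \<inter> U)" using U V by blast
  have \<tau>x: "\<tau> (\<psi> x) = \<phi> x" by (simp add: \<tau>_def inv_chart[OF V])
  show "coordinate_vector A (V, \<psi>) x w f =
    coordinate_vector A (U, \<phi>) x (frechet_derivative (\<phi> \<circ> inv_into V \<psi>) (at (\<psi> x)) w) f"
  proof (cases "smooth_near A f x")
    case True
    have "frechet_derivative (f \<circ> inv_into V \<psi>) (at (\<psi> x)) =
        frechet_derivative ((f \<circ> inv_into U \<phi>) \<circ> \<tau>) (at (\<psi> x))"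
      using inv_chart[OF V(1)] inv_chart[OF U(1)]
      by (intro frechet_derivative_cong_open[OF smooth_on_open[OF \<tau>] \<psi>x]) (auto simp: \<tau>_def)
    also have "\<dots> = frechet_derivative (f \<circ> inv_into U \<phi>) (at (\<tau> (\<psi> x))) \<circ> frechet_derivative \<tau> (at (\<psi> x))"
      by (intro frechet_derivative_compose smooth_on_differentiable[OF \<tau> \<psi>x])
        (simp add: \<tau>x smooth_near_differentiable[OF True U])
    finally show ?thesis using True by (simp add: coordinate_vector_smooth \<tau>x) (simp add: \<tau>_def)
  qed (simp add: coordinate_vector_not_smooth)
qed

lemma tangent_in_chart:
  assumes "v \<in> tangent_space A x" "(U, \<phi>) \<in> A" "x \<in> U"
  obtains w where "v = coordinate_vector A (U, \<phi>) x w"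
  using assms(1) coordinate_vector_transition[OF assms(2,3)] unfolding tangent_space_def by force

lemma points_chartE:
  assumes "x \<in> points A" obtains U \<phi> where "(U, \<phi>) \<in> A" "x \<in> U"
  using assms unfolding points_def by blast

lemma points_chartI: "(U, \<phi>) \<in> A \<Longrightarrow> x \<in> U \<Longrightarrow> x \<in> points A"
  unfolding points_def by blast

lemma tangent_space_chartE:
  assumes "v \<in> tangent_space A x"
  obtains U \<phi> w where "(U, \<phi>) \<in> A" "x \<in> U" "v = coordinate_vector A (U, \<phi>) x w"
  using assms unfolding tangent_space_def by force

lemma coordinate_vector_linear:
  assumes "(U, \<phi>) \<in> A" "x \<in> U"
  shows "coordinate_vector A (U, \<phi>) x (a *\<^sub>R w + b *\<^sub>R w') =
    (\<lambda>f. a * coordinate_vector A (U, \<phi>) x w f + b * coordinate_vector A (U, \<phi>) x w' f)"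
proof
  fix f
  show "coordinate_vector A (U, \<phi>) x (a *\<^sub>R w + b *\<^sub>R w') f =
    a * coordinate_vector A (U, \<phi>) x w f + b * coordinate_vector A (U, \<phi>) x w' f"
  proof (cases "smooth_near A f x")
    case True
    then show ?thesis
      using linear_frechet_derivative[OF smooth_near_differentiable[OF True assms]]
      by (simp add: coordinate_vector_smooth linear_add linear_cmul)
  qed (simp add: coordinate_vector_not_smooth)
qed

lemma tangent_space_linear:
  assumes u: "u \<in> tangent_space A x" and v: "v \<in> tangent_space A x"
  shows "(\<lambda>f. a * u f + b * v f) \<in> tangent_space A x"
proof -
  obtain U \<phi> w where U: "(U, \<phi>) \<in> A" "x \<in> U" and w: "u = coordinate_vector A (U, \<phi>) x w"
    using tangent_space_chartE[OF u] .
  obtain w' where w': "v = coordinate_vector A (U, \<phi>) x w'" using tangent_in_chart[OF v U] .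
  show ?thesis
    unfolding w w' coordinate_vector_linear[OF U, symmetric]
    by (rule coordinate_vector_in_tangent_space[OF U])
qed

lemma tangent_not_smooth: "v \<in> tangent_space A x \<Longrightarrow> \<not> smooth_near A f x \<Longrightarrow> v f = 0"
  using coordinate_vector_not_smooth unfolding tangent_space_def by blast

text \<open>Derivatives are local, and so is the case distinction in
  \<open>coordinate_vector\<close>: smoothness near \<open>x\<close> depends only on the values near
  \<open>x\<close>, so the default 0 is taken for \<open>f\<close> and \<open>g\<close>
  alike.\<close>

lemma tangent_cong_near:
  assumes v: "v \<in> tangent_space A x" and U: "(U, \<phi>) \<in> A" "x \<in> U" and S: "open S" "\<phi> x \<in> S"
    and eq: "\<And>y. y \<in> U \<Longrightarrow> \<phi> y \<in> S \<Longrightarrow> f y = g y"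
  shows "v f = v g"
proof (cases "smooth_near A f x")
  case True
  have g: "smooth_near A g x" by (rule smooth_near_cong[OF U S eq True])
  obtain w where w: "v = coordinate_vector A (U, \<phi>) x w" using tangent_in_chart[OF v U] .
  have "frechet_derivative (f \<circ> inv_into U \<phi>) (at (\<phi> x)) = frechet_derivative (g \<circ> inv_into U \<phi>) (at (\<phi> x))"
    by (rule frechet_derivative_cong_open[where S = "S \<inter> \<phi> ` U"])
      (use S U open_chart[OF U(1)] eq in \<open>auto simp: inv_chart[OF U(1)]\<close>)
  then show ?thesis using True g by (simp add: w coordinate_vector_smooth)
next
  case False
  have "\<not> smooth_near A g x"
  proof
    assume g: "smooth_near A g x"
    have "smooth_near A f x" by (rule smooth_near_cong[OF U S _ g]) (simp add: eq)
    then show False using False by blast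
  qed
  then show ?thesis using False tangent_not_smooth[OF v] by simp
qed

lemma tangent_cong:
  assumes "v \<in> tangent_space A x" "(U, \<phi>) \<in> A" "x \<in> U" "\<And>y. y \<in> U \<Longrightarrow> f y = g y"
  shows "v f = v g"
  using tangent_cong_near[OF assms(1-3), of UNIV f g] assms(4) by simp

lemma tangent_const: "v \<in> tangent_space A x \<Longrightarrow> v (\<lambda>y. c) = 0"
  by (erule tangent_space_chartE) (simp add: coordinate_vector_smooth smooth_near_const o_def)

lemma tangent_add:
  assumes v: "v \<in> tangent_space A x" and f: "smooth_near A f x" and g: "smooth_near A g x"
  shows "v (\<lambda>y. f y + g y) = v f + v g"
proof -
  obtain U \<phi> w where U: "(U, \<phi>) \<in> A" "x \<in> U" and w: "v = coordinate_vector A (U, \<phi>) x w"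
    using tangent_space_chartE[OF v] .
  note d = has_derivative_add[OF smooth_near_differentiable[OF f U, THEN has_frechet_derivative]
      smooth_near_differentiable[OF g U, THEN has_frechet_derivative]]
  show ?thesis
    using frechet_derivative_at[OF d, symmetric]
    by (simp add: w coordinate_vector_smooth f g smooth_near_add o_def)
qed

lemma tangent_mult:
  assumes v: "v \<in> tangent_space A x" and f: "smooth_near A f x" and g: "smooth_near A g x"
  shows "v (\<lambda>y. f y * g y) = v f * g x + f x * v g"
proof -
  obtain U \<phi> w where U: "(U, \<phi>) \<in> A" "x \<in> U" and w: "v = coordinate_vector A (U, \<phi>) x w"
    using tangent_space_chartE[OF v] .
  note d = has_derivative_mult[OF smooth_near_differentiable[OF f U, THEN has_frechet_derivative]
      smooth_near_differentiable[OF g U, THEN has_frechet_derivative]]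
  show ?thesis
    using frechet_derivative_at[OF d, symmetric]
    by (simp add: w coordinate_vector_smooth f g smooth_near_mult o_def inv_chart[OF U])
qed

lemma tangent_uminus:
  "v \<in> tangent_space A x \<Longrightarrow> smooth_near A f x \<Longrightarrow> v (\<lambda>y. - f y) = - v f"
  using tangent_mult[OF _ smooth_near_const[of "-1"], of v x f] tangent_const[of v x "-1"] by simp

lemma tangent_sum:
  assumes v: "v \<in> tangent_space A x" and f: "\<And>i. i \<in> I \<Longrightarrow> smooth_near A (f i) x"
  shows "v (\<lambda>y. \<Sum>i\<in>I. f i y) = (\<Sum>i\<in>I. v (f i))"
  using f
proof (induction I rule: infinite_finite_induct)
  case (insert i I)
  then show ?case using tangent_add[OF v, of "f i" "\<lambda>y. \<Sum>i\<in>I. f i y"] smooth_near_sum[of I f x] by simp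
qed (simp_all add: tangent_const[OF v])

lemma tangent_sum_list:
  assumes v: "v \<in> tangent_space A x" and f: "\<And>i. i \<in> set L \<Longrightarrow> smooth_near A (f i) x"
  shows "v (\<lambda>y. \<Sum>i\<leftarrow>L. f i y) = (\<Sum>i\<leftarrow>L. v (f i))"
  using f
proof (induction L)
  case (Cons i L)
  then show ?case using tangent_add[OF v, of "f i" "\<lambda>y. \<Sum>i\<leftarrow>L. f i y"] smooth_near_sum_list[of L f x] by simp
qed (simp add: tangent_const[OF v])

lemma coordinate_vector_coordinate:
  assumes U: "(U, \<phi>) \<in> A" "x \<in> U"
  shows "coordinate_vector A (U, \<phi>) x w (\<lambda>y. \<phi> y \<bullet> b) = w \<bullet> b"
proof -
  have "frechet_derivative ((\<lambda>y. \<phi> y \<bullet> b) \<circ> inv_into U \<phi>) (at (\<phi> x)) =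
      frechet_derivative (\<lambda>e. e \<bullet> b) (at (\<phi> x))"
    by (rule frechet_derivative_cong_open[OF open_chart[OF U(1)]]) (use U inv_chart[OF U(1)] in auto)
  also have "\<dots> = (\<lambda>w. w \<bullet> b)"
    using bounded_linear_imp_has_derivative[OF bounded_linear_inner_left] frechet_derivative_at by metis
  finally show ?thesis by (simp add: coordinate_vector_smooth smooth_near_coordinate[OF U])
qed

lemma tangent_coordinates:
  assumes v: "v \<in> tangent_space A x" and U: "(U, \<phi>) \<in> A" "x \<in> U"
  shows "v = coordinate_vector A (U, \<phi>) x (\<Sum>b\<in>Basis. v (\<lambda>y. \<phi> y \<bullet> b) *\<^sub>R b)"
proof -
  obtain w where w: "v = coordinate_vector A (U, \<phi>) x w" using tangent_in_chart[OF v U] .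
  have "(\<Sum>b\<in>Basis. v (\<lambda>y. \<phi> y \<bullet> b) *\<^sub>R b) = w"
    by (simp add: w coordinate_vector_coordinate[OF U] euclidean_representation)
  then show ?thesis using w by simp
qed

lemma tangent_expand:
  assumes v: "v \<in> tangent_space A x" and U: "(U, \<phi>) \<in> A" "x \<in> U" and f: "smooth_near A f x"
  shows "v f = (\<Sum>b\<in>Basis. v (\<lambda>y. \<phi> y \<bullet> b) * coordinate_vector A (U, \<phi>) x b f)"
proof -
  have lin: "linear (frechet_derivative (f \<circ> inv_into U \<phi>) (at (\<phi> x)))"
    by (rule linear_frechet_derivative[OF smooth_near_differentiable[OF f U]])
  have "v f = frechet_derivative (f \<circ> inv_into U \<phi>) (at (\<phi> x)) (\<Sum>b\<in>Basis. v (\<lambda>y. \<phi> y \<bullet> b) *\<^sub>R b)"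
    by (subst tangent_coordinates[OF v U]) (simp add: coordinate_vector_smooth f)
  then show ?thesis using lin by (simp add: linear_sum linear_cmul coordinate_vector_smooth f)
qed

section \<open>Second-order terms and the Lie bracket\<close>

text \<open>Resolves the case distinction in \<open>coordinate_vector\<close> on a whole
  neighbourhood instead of at one point, so that a partial derivative of \<open>f\<close> can be
  differentiated once more.\<close>

lemma smooth_near_coordinate_derivative:
  assumes U: "(U, \<phi>) \<in> A" "x \<in> U" and f: "smooth_near A f x"
  obtains S where "open S" "\<phi> x \<in> S" "S \<subseteq> \<phi> ` U" "smooth_on S (f \<circ> inv_into U \<phi>)"
    "\<forall>y\<in>U. \<phi> y \<in> S \<longrightarrow> smooth_near A f y"
    "\<forall>w. smooth_on S ((\<lambda>y. coordinate_vector A (U, \<phi>) y w f) \<circ> inv_into U \<phi>)"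
    "\<forall>w. \<forall>e\<in>S. ((\<lambda>y. coordinate_vector A (U, \<phi>) y w f) \<circ> inv_into U \<phi>) e =
       frechet_derivative (f \<circ> inv_into U \<phi>) (at e) w"
proof -
  obtain S where S: "\<phi> x \<in> S" "S \<subseteq> \<phi> ` U" "smooth_on S (f \<circ> inv_into U \<phi>)"
    using smooth_near_chartE[OF f U] .
  have near: "smooth_near A f y" if "y \<in> U" "\<phi> y \<in> S" for y
    using smooth_near_chartI[OF U(1) that S(2,3)] .
  have eq: "((\<lambda>y. coordinate_vector A (U, \<phi>) y w f) \<circ> inv_into U \<phi>) e =
       frechet_derivative (f \<circ> inv_into U \<phi>) (at e) w" if e: "e \<in> S" for w e
  proof -
    obtain y where "y \<in> U" "e = \<phi> y" using S e by blast
    then show ?thesis using near e by (simp add: inv_chart[OF U(1)] coordinate_vector_smooth)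
  qed
  have "smooth_on S ((\<lambda>y. coordinate_vector A (U, \<phi>) y w f) \<circ> inv_into U \<phi>)" for w
    by (rule smooth_on_cong[OF smooth_on_derivative[OF S(3)]]) (simp add: eq[simplified])
  then show ?thesis using that[OF smooth_on_open[OF S(3)]] S near eq by blast
qed

lemma smooth_vector_fieldD:
  assumes "smooth_vector_field A X" "x \<in> points A"
  shows "X x \<in> tangent_space A x" "smooth_near A f x \<Longrightarrow> smooth_near A (\<lambda>y. X y f) x"
  using assms unfolding smooth_vector_field_def by auto

text \<open>Separates the part that differentiates the components of \<open>Y\<close> from the
  Hessian of \<open>f\<close> in the directions of \<open>v\<close> and \<open>Y x\<close>. Only the
  Hessian part is of second order in \<open>f\<close>, and it is symmetric.\<close>

lemma vector_field_derivative_expand: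
  assumes U: "(U, \<phi>) \<in> A" "x \<in> U" and v: "v \<in> tangent_space A x"
    and Y: "smooth_vector_field A Y" and f: "smooth_near A f x"
  shows "v (\<lambda>y. Y y f) =
    (\<Sum>b\<in>Basis. v (\<lambda>y. Y y (\<lambda>y. \<phi> y \<bullet> b)) * coordinate_vector A (U, \<phi>) x b f) +
    frechet_derivative (\<lambda>e. frechet_derivative (f \<circ> inv_into U \<phi>) (at e) (\<Sum>b\<in>Basis. v (\<lambda>y. \<phi> y \<bullet> b) *\<^sub>R b))
      (at (\<phi> x)) (\<Sum>b\<in>Basis. Y x (\<lambda>y. \<phi> y \<bullet> b) *\<^sub>R b)"
proof -
  obtain S where S: "open S" "\<phi> x \<in> S" "S \<subseteq> \<phi> ` U" "smooth_on S (f \<circ> inv_into U \<phi>)"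
    and near: "\<forall>y\<in>U. \<phi> y \<in> S \<longrightarrow> smooth_near A f y"
    and cs: "\<forall>w. smooth_on S ((\<lambda>y. coordinate_vector A (U, \<phi>) y w f) \<circ> inv_into U \<phi>)"
    and eq: "\<forall>w. \<forall>e\<in>S. ((\<lambda>y. coordinate_vector A (U, \<phi>) y w f) \<circ> inv_into U \<phi>) e =
       frechet_derivative (f \<circ> inv_into U \<phi>) (at e) w"
    using smooth_near_coordinate_derivative[OF U f] .
  note x = points_chartI[OF U]
  define \<xi> where "\<xi> = (\<Sum>b\<in>Basis. v (\<lambda>y. \<phi> y \<bullet> b) *\<^sub>R b)"
  define D where "D = (\<lambda>u. frechet_derivative (\<lambda>e. frechet_derivative (f \<circ> inv_into U \<phi>) (at e) u) (at (\<phi> x)))"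
  have cnear: "smooth_near A (\<lambda>y. coordinate_vector A (U, \<phi>) y w f) x" for w
    using smooth_near_chartI[OF U S(2,3)] cs by blast
  have ynear: "smooth_near A (\<lambda>y. Y y (\<lambda>y. \<phi> y \<bullet> b)) x" for b
    by (rule smooth_vector_fieldD(2)[OF Y x smooth_near_coordinate[OF U]])
  \<comment> \<open>The two derivatives are exchanged here so that the basis vector \<open>b\<close>
    occupies the outer slot, in which \<open>D \<xi>\<close> is linear; the sum over
    \<open>b\<close> can then be collected into the single direction \<open>Y x\<close>.\<close>
  have vc: "v (\<lambda>y. coordinate_vector A (U, \<phi>) y b f) = D \<xi> b" for b
  proof -
    have "v (\<lambda>y. coordinate_vector A (U, \<phi>) y b f) =
      frechet_derivative ((\<lambda>y. coordinate_vector A (U, \<phi>) y b f) \<circ> inv_into U \<phi>) (at (\<phi> x)) \<xi>"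
      by (subst tangent_coordinates[OF v U]) (simp add: coordinate_vector_smooth[OF cnear] \<xi>_def)
    also have "frechet_derivative ((\<lambda>y. coordinate_vector A (U, \<phi>) y b f) \<circ> inv_into U \<phi>) (at (\<phi> x)) = D b"
      unfolding D_def by (rule frechet_derivative_cong_open[OF S(1,2) eq[rule_format]])
    finally show ?thesis
      unfolding D_def using smooth_on_second_derivative_symmetric[OF S(4,2), of b \<xi>] by (rule trans)
  qed
  have "v (\<lambda>y. Y y f) =
      v (\<lambda>y. \<Sum>b\<in>Basis. Y y (\<lambda>y. \<phi> y \<bullet> b) * coordinate_vector A (U, \<phi>) y b f)"
  proof (rule tangent_cong_near[OF v U S(1,2)])
    fix y assume y: "y \<in> U" "\<phi> y \<in> S"
    show "Y y f = (\<Sum>b\<in>Basis. Y y (\<lambda>y. \<phi> y \<bullet> b) * coordinate_vector A (U, \<phi>) y b f)"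
      using smooth_vector_fieldD(1)[OF Y points_chartI[OF U(1) y(1)]] U(1) y(1) near[rule_format, OF y]
      by (rule tangent_expand)
  qed
  also have "\<dots> = (\<Sum>b\<in>Basis. v (\<lambda>y. Y y (\<lambda>y. \<phi> y \<bullet> b) * coordinate_vector A (U, \<phi>) y b f))"
    by (rule tangent_sum[OF v]) (rule smooth_near_mult[OF ynear cnear])
  also have "\<dots> = (\<Sum>b\<in>Basis. v (\<lambda>y. Y y (\<lambda>y. \<phi> y \<bullet> b)) * coordinate_vector A (U, \<phi>) x b f
      + Y x (\<lambda>y. \<phi> y \<bullet> b) * D \<xi> b)"
    by (intro sum.cong refl) (simp add: tangent_mult[OF v ynear cnear] vc)
  also have "\<dots> = (\<Sum>b\<in>Basis. v (\<lambda>y. Y y (\<lambda>y. \<phi> y \<bullet> b)) * coordinate_vector A (U, \<phi>) x b f)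
      + D \<xi> (\<Sum>b\<in>Basis. Y x (\<lambda>y. \<phi> y \<bullet> b) *\<^sub>R b)"
  proof -
    have "linear (D \<xi>)"
      unfolding D_def
      by (intro linear_frechet_derivative smooth_on_differentiable[OF smooth_on_derivative[OF S(4)] S(2)])
    then show ?thesis by (simp add: sum.distrib linear_sum linear_cmul)
  qed
  finally show ?thesis by (simp add: D_def \<xi>_def)
qed

text \<open>The Hessian terms of \<open>X(Y f)\<close> and \<open>Y(X f)\<close> cancel, so the
  bracket is the coordinate vector \<open>w\<close> whose components are its values on the
  coordinate functions. On functions that are not smooth near \<open>x\<close> both operators are
  0.\<close>

lemma lie_bracket_tangent:
  assumes X: "smooth_vector_field A X" and Y: "smooth_vector_field A Y" and x: "x \<in> points A"
  shows "lie_bracket A X Y x \<in> tangent_space A x"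
proof -
  obtain U \<phi> where U: "(U, \<phi>) \<in> A" "x \<in> U" using points_chartE[OF x] .
  note Xx = smooth_vector_fieldD(1)[OF X x] and Yx = smooth_vector_fieldD(1)[OF Y x]
  define w where "w = (\<Sum>b\<in>Basis. (X x (\<lambda>y. Y y (\<lambda>y. \<phi> y \<bullet> b)) - Y x (\<lambda>y. X y (\<lambda>y. \<phi> y \<bullet> b))) *\<^sub>R b)"
  have "lie_bracket A X Y x f = coordinate_vector A (U, \<phi>) x w f" for f
  proof (cases "smooth_near A f x")
    case f: True
    obtain S where S: "\<phi> x \<in> S" "S \<subseteq> \<phi> ` U" "smooth_on S (f \<circ> inv_into U \<phi>)"
      using smooth_near_chartE[OF f U] .
    have lin: "linear (frechet_derivative (f \<circ> inv_into U \<phi>) (at (\<phi> x)))"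
      by (rule linear_frechet_derivative[OF smooth_near_differentiable[OF f U]])
    have "lie_bracket A X Y x f = (\<Sum>b\<in>Basis. (X x (\<lambda>y. Y y (\<lambda>y. \<phi> y \<bullet> b)) - Y x (\<lambda>y. X y (\<lambda>y. \<phi> y \<bullet> b)))
        * coordinate_vector A (U, \<phi>) x b f)"
    proof -
      have bracket: "lie_bracket A X Y x f = X x (\<lambda>y. Y y f) - Y x (\<lambda>y. X y f)"
        using f by (simp add: lie_bracket_def)
      have sym: "frechet_derivative (\<lambda>e. frechet_derivative (f \<circ> inv_into U \<phi>) (at e) (\<Sum>b\<in>Basis. X x (\<lambda>y. \<phi> y \<bullet> b) *\<^sub>R b))
          (at (\<phi> x)) (\<Sum>b\<in>Basis. Y x (\<lambda>y. \<phi> y \<bullet> b) *\<^sub>R b) =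
        frechet_derivative (\<lambda>e. frechet_derivative (f \<circ> inv_into U \<phi>) (at e) (\<Sum>b\<in>Basis. Y x (\<lambda>y. \<phi> y \<bullet> b) *\<^sub>R b))
          (at (\<phi> x)) (\<Sum>b\<in>Basis. X x (\<lambda>y. \<phi> y \<bullet> b) *\<^sub>R b)"
        by (rule smooth_on_second_derivative_symmetric[OF S(3,1)])
      have "lie_bracket A X Y x f =
        (\<Sum>b\<in>Basis. X x (\<lambda>y. Y y (\<lambda>y. \<phi> y \<bullet> b)) * coordinate_vector A (U, \<phi>) x b f) -
        (\<Sum>b\<in>Basis. Y x (\<lambda>y. X y (\<lambda>y. \<phi> y \<bullet> b)) * coordinate_vector A (U, \<phi>) x b f)"
        unfolding bracket vector_field_derivative_expand[OF U Xx Y f]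
          vector_field_derivative_expand[OF U Yx X f] sym by (rule add_diff_cancel_right)
      then show ?thesis unfolding sum_subtractf[symmetric] left_diff_distrib .
    qed
    also have "\<dots> = coordinate_vector A (U, \<phi>) x w f"
      using lin f by (simp add: w_def coordinate_vector_smooth linear_sum linear_cmul)
    finally show ?thesis .
  qed (simp add: lie_bracket_def coordinate_vector_not_smooth)
  then have "lie_bracket A X Y x = coordinate_vector A (U, \<phi>) x w" by blast
  then show ?thesis using coordinate_vector_in_tangent_space[OF U] by simp
qed

section \<open>One-forms with local expressions\<close>

text \<open>A list of pairs \<open>(f, g)\<close> represents the local expression \<open>\<Sum> f dg\<close>.\<close>

definition form_on :: "'m set \<Rightarrow> 'm one_form \<Rightarrow> (('m \<Rightarrow> real) \<times> ('m \<Rightarrow> real)) list \<Rightarrow> bool" where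
  "form_on U \<omega> L \<longleftrightarrow>
     (\<forall>y\<in>U. (\<forall>a\<in>set L. smooth_near A (fst a) y \<and> smooth_near A (snd a) y) \<and>
        (\<forall>v\<in>tangent_space A y. \<omega> y v = (\<Sum>a\<leftarrow>L. fst a y * v (snd a))))"

text \<open>The list may have any length and its functions need not be coordinates, so expressions
  can be pulled back, negated and extended by a pair such as \<open>(h, snd)\<close> without being
  normalised.\<close>

definition smooth_one_form :: "'m one_form \<Rightarrow> bool" where
  "smooth_one_form \<omega> \<longleftrightarrow> (\<forall>(U, \<phi>)\<in>A. \<exists>L. form_on U \<omega> L)"

lemma form_onD:
  assumes "form_on U \<omega> L" "y \<in> U"
  shows "a \<in> set L \<Longrightarrow> smooth_near A (fst a) y" "a \<in> set L \<Longrightarrow> smooth_near A (snd a) y"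
    "v \<in> tangent_space A y \<Longrightarrow> \<omega> y v = (\<Sum>a\<leftarrow>L. fst a y * v (snd a))"
  using assms unfolding form_on_def by auto

lemma smooth_one_form_interior_product:
  assumes L: "form_on U \<omega> L" and U: "(U, \<phi>) \<in> A" "x \<in> U" and Y: "smooth_vector_field A Y"
  shows "smooth_near A (interior_product Y \<omega>) x"
    and "v \<in> tangent_space A x \<Longrightarrow>
      v (interior_product Y \<omega>) = (\<Sum>a\<leftarrow>L. v (fst a) * Y x (snd a) + fst a x * v (\<lambda>y. Y y (snd a)))"
proof -
  have eq: "(\<Sum>a\<leftarrow>L. fst a y * Y y (snd a)) = interior_product Y \<omega> y" if "y \<in> U" for y
    using form_onD(3)[OF L that smooth_vector_fieldD(1)[OF Y points_chartI[OF U(1) that]]]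
    by (simp add: interior_product_def)
  have sm: "smooth_near A (\<lambda>y. fst a y * Y y (snd a)) x" if "a \<in> set L" for a
    using form_onD(1,2)[OF L U(2) that] smooth_vector_fieldD(2)[OF Y points_chartI[OF U]]
    by (intro smooth_near_mult) auto
  show "smooth_near A (interior_product Y \<omega>) x"
    by (rule smooth_near_cong[OF U open_UNIV UNIV_I eq smooth_near_sum_list[OF sm]])
  assume v: "v \<in> tangent_space A x"
  have "v (interior_product Y \<omega>) = v (\<lambda>y. \<Sum>a\<leftarrow>L. fst a y * Y y (snd a))"
    by (rule tangent_cong[OF v U eq[symmetric]])
  also have "\<dots> = (\<Sum>a\<leftarrow>L. v (\<lambda>y. fst a y * Y y (snd a)))"
    by (rule tangent_sum_list[OF v sm])
  also have "\<dots> = (\<Sum>a\<leftarrow>L. v (fst a) * Y x (snd a) + fst a x * v (\<lambda>y. Y y (snd a)))"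
  proof (intro arg_cong[where f = sum_list] map_cong refl)
    fix a assume a: "a \<in> set L"
    then show "v (\<lambda>y. fst a y * Y y (snd a)) = v (fst a) * Y x (snd a) + fst a x * v (\<lambda>y. Y y (snd a))"
      using form_onD(1,2)[OF L U(2) a] smooth_vector_fieldD(2)[OF Y points_chartI[OF U]]
      by (intro tangent_mult v) auto
  qed
  finally show "v (interior_product Y \<omega>) =
    (\<Sum>a\<leftarrow>L. v (fst a) * Y x (snd a) + fst a x * v (\<lambda>y. Y y (snd a)))" .
qed

text \<open>A local expression is valid on tangent vectors only; \<open>lie_bracket_tangent\<close>
  is what permits it to be evaluated on the bracket.\<close>

lemma interior_product_lie_bracket:
  assumes L: "form_on U \<omega> L" and U: "(U, \<phi>) \<in> A" "x \<in> U"
    and X: "smooth_vector_field A X" and Y: "smooth_vector_field A Y"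
  shows "interior_product (lie_bracket A X Y) \<omega> x =
    (\<Sum>a\<leftarrow>L. fst a x * (X x (\<lambda>y. Y y (snd a)) - Y x (\<lambda>y. X y (snd a))))"
proof -
  have "interior_product (lie_bracket A X Y) \<omega> x = (\<Sum>a\<leftarrow>L. fst a x * lie_bracket A X Y x (snd a))"
    unfolding interior_product_def
    using form_onD(3)[OF L U(2)] lie_bracket_tangent[OF X Y points_chartI[OF U]] by simp
  also have "\<dots> = (\<Sum>a\<leftarrow>L. fst a x * (X x (\<lambda>y. Y y (snd a)) - Y x (\<lambda>y. X y (snd a))))"
    using form_onD(2)[OF L U(2)]
    by (intro arg_cong[where f = sum_list] map_cong refl) (simp add: lie_bracket_def)
  finally show ?thesis .
qed

text \<open>The Leibniz rule applied to \<open>\<Sum> f Y(g)\<close> and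
  \<open>\<Sum> f X(g)\<close> leaves second-order terms \<open>f X(Y g)\<close> and
  \<open>f Y(X g)\<close>; they are exactly those of the bracket term, and
  \<open>\<Sum> df \<and> dg\<close> remains.\<close>

lemma exterior_derivative_form_on:
  assumes L: "form_on U \<omega> L" and U: "(U, \<phi>) \<in> A" "x \<in> U"
    and X: "smooth_vector_field A X" and Y: "smooth_vector_field A Y"
  shows "exterior_derivative A \<omega> X Y x =
    (\<Sum>a\<leftarrow>L. X x (fst a) * Y x (snd a) - Y x (fst a) * X x (snd a))"
  unfolding exterior_derivative_def lie_function_def interior_product_lie_bracket[OF L U X Y]
    smooth_one_form_interior_product(2)[OF L U X smooth_vector_fieldD(1)[OF Y points_chartI[OF U]]]
    smooth_one_form_interior_product(2)[OF L U Y smooth_vector_fieldD(1)[OF X points_chartI[OF U]]]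
    sum_list_subtractf[symmetric]
  by (intro arg_cong[where f = sum_list] map_cong refl) (simp add: algebra_simps)

text \<open>The sign cannot be pulled out of \<open>\<omega>\<close> directly, since a
  \<open>one_form\<close> is not linear by type; it is pulled out of the local expression.\<close>

lemma interior_product_lie_bracket_antisym:
  assumes \<omega>: "smooth_one_form \<omega>" and x: "x \<in> points A"
    and X: "smooth_vector_field A X" and Y: "smooth_vector_field A Y"
  shows "interior_product (lie_bracket A X Y) \<omega> x = - interior_product (lie_bracket A Y X) \<omega> x"
proof -
  obtain U \<phi> where U: "(U, \<phi>) \<in> A" "x \<in> U" using points_chartE[OF x] .
  obtain L where L: "form_on U \<omega> L" using \<omega> U unfolding smooth_one_form_def by blast
  show ?thesis
    unfolding interior_product_lie_bracket[OF L U X Y] interior_product_lie_bracket[OF L U Y X]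
      uminus_sum_list_map
    by (intro arg_cong[where f = sum_list] map_cong refl) (simp add: algebra_simps)
qed

lemma smooth_vector_field_add:
  assumes X: "smooth_vector_field A X" and Y: "smooth_vector_field A Y"
  shows "smooth_vector_field A (\<lambda>x f. X x f + Y x f)"
  unfolding smooth_vector_field_def
proof safe
  fix x assume x: "x \<in> points A"
  show "(\<lambda>f. X x f + Y x f) \<in> tangent_space A x"
    using tangent_space_linear[OF smooth_vector_fieldD(1)[OF X x] smooth_vector_fieldD(1)[OF Y x], of 1 1]
    by simp
  show "smooth_near A (\<lambda>y. X y f + Y y f) x" if "smooth_near A f x" for f
    using smooth_vector_fieldD(2)[OF X x that] smooth_vector_fieldD(2)[OF Y x that]
    by (rule smooth_near_add)
qed

end

lemma smooth_manifold_smooth_atlas: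
  assumes "smooth_manifold T A" shows "smooth_atlas A"
proof
  fix U \<phi> assume U: "(U, \<phi>) \<in> A"
  then have h: "homeomorphic_map (subtopology T U) (top_of_set (\<phi> ` U)) \<phi>" and T: "openin T U"
    and "open (\<phi> ` U)" using assms unfolding smooth_manifold_def by auto
  show "open (\<phi> ` U)" by fact
  have "topspace (subtopology T U) = U" using openin_subset[OF T] by auto
  then show "inj_on \<phi> U" using homeomorphic_imp_injective_map[OF h] by simp
  fix V \<psi> assume "(V, \<psi>) \<in> A"
  then show "smooth_on (\<phi> ` (U \<inter> V)) (\<psi> \<circ> inv_into U \<phi>)"
    using assms U unfolding smooth_manifold_def by fast
qed

section \<open>Products with the line and cotangent bundles\<close>

context smooth_atlas
begin

lemma smooth_near_coordinate_vector:
  assumes U: "(U, \<phi>) \<in> A" "x \<in> U" and f: "smooth_near A f x"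
  shows "smooth_near A (\<lambda>y. coordinate_vector A (U, \<phi>) y w f) x"
proof -
  obtain S where S: "open S" "\<phi> x \<in> S" "S \<subseteq> \<phi> ` U" "smooth_on S (f \<circ> inv_into U \<phi>)"
    and "\<forall>y\<in>U. \<phi> y \<in> S \<longrightarrow> smooth_near A f y"
    and cs: "\<forall>w. smooth_on S ((\<lambda>y. coordinate_vector A (U, \<phi>) y w f) \<circ> inv_into U \<phi>)"
    and "\<forall>w. \<forall>e\<in>S. ((\<lambda>y. coordinate_vector A (U, \<phi>) y w f) \<circ> inv_into U \<phi>) e =
       frechet_derivative (f \<circ> inv_into U \<phi>) (at e) w"
    using smooth_near_coordinate_derivative[OF U f] .
  show ?thesis using smooth_near_chartI[OF U S(2,3) cs[rule_format]] .
qed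

lemma form_on_append:
  assumes "form_on U \<omega> L" "form_on U \<omega>' L'"
  shows "form_on U (\<lambda>x v. \<omega> x v + \<omega>' x v) (L @ L')"
  using assms unfolding form_on_def by auto

lemma form_on_uminus:
  assumes "form_on U \<omega> L"
  shows "form_on U (\<lambda>x v. - \<omega> x v) (map (\<lambda>a. (\<lambda>y. - fst a y, snd a)) L)"
  using assms unfolding form_on_def by (auto simp: smooth_near_uminus uminus_sum_list_map o_def)

lemma form_on_mult_differential:
  assumes "\<And>y. y \<in> U \<Longrightarrow> smooth_near A f y" "\<And>y. y \<in> U \<Longrightarrow> smooth_near A g y"
  shows "form_on U (\<lambda>x v. f x * differential g x v) [(f, g)]"
  using assms unfolding form_on_def differential_def by auto

end

section \<open>Projections of fibred atlases\<close>

text \<open>Common pattern of a cotangent chart over a chart of the base and of a product chart over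
  its first factor: in coordinates the projection is \<open>fst\<close>, and the coordinates of a
  fibre fill the whole space.\<close>

definition fibred_chart :: "('m, 'e) chart \<Rightarrow> ('m \<times> 'k, 'e \<times> 'd) chart \<Rightarrow> bool" where
  "fibred_chart = (\<lambda>(U, \<phi>) (V, \<psi>).
     inj_on \<psi> V \<and> (\<forall>z\<in>V. fst z \<in> U \<and> fst (\<psi> z) = \<phi> (fst z)) \<and> \<psi> ` V = \<phi> ` U \<times> UNIV)"

locale fibration =
  base: smooth_atlas A + total: smooth_atlas B
  for A :: "('m, 'e::euclidean_space) atlas" and B :: "('m \<times> 'k, 'e \<times> 'd::euclidean_space) atlas" +
  assumes fibred: "(V, \<psi>) \<in> B \<Longrightarrow> \<exists>c\<in>A. fibred_chart c (V, \<psi>)"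
begin

lemma fibredE:
  assumes "(V, \<psi>) \<in> B"
  obtains U \<phi> where "(U, \<phi>) \<in> A" "fibred_chart (U, \<phi>) (V, \<psi>)"
  using fibred[OF assms] by auto

lemma fibred_chartD:
  assumes "fibred_chart (U, \<phi>) (V, \<psi>)"
  shows "inj_on \<psi> V" "z \<in> V \<Longrightarrow> fst z \<in> U" "z \<in> V \<Longrightarrow> fst (\<psi> z) = \<phi> (fst z)"
    "\<psi> ` V = \<phi> ` U \<times> UNIV"
  using assms unfolding fibred_chart_def by auto

lemma fst_inv_chart:
  assumes U: "(U, \<phi>) \<in> A" and c: "fibred_chart (U, \<phi>) (V, \<psi>)" and e: "fst e \<in> \<phi> ` U"
  shows "fst (inv_into V \<psi> e) = inv_into U \<phi> (fst e)"
proof -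
  have "e \<in> \<psi> ` V" using fibred_chartD(4)[OF c] e by (cases e) auto
  then obtain z where z: "z \<in> V" "e = \<psi> z" by blast
  then have "inv_into V \<psi> e = z" using fibred_chartD(1)[OF c] by simp
  then show ?thesis
    using z fibred_chartD(2,3)[OF c z(1)] base.inv_chart[OF U] by simp
qed

text \<open>Upwards, compose with the projection; downwards, restrict to the section
  \<open>e \<mapsto> (e, k)\<close> with the fibre coordinate \<open>k\<close> of \<open>z\<close>.
  The downward direction serves the default value 0: it ensures that a pushed-forward vector
  vanishes on functions that are not smooth near \<open>fst z\<close>.\<close>

lemma smooth_near_fst_iff:
  assumes U: "(U, \<phi>) \<in> A" and V: "(V, \<psi>) \<in> B" "z \<in> V" and c: "fibred_chart (U, \<phi>) (V, \<psi>)"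
  shows "smooth_near B (f \<circ> fst) z \<longleftrightarrow> smooth_near A f (fst z)"
proof
  note z = fibred_chartD(2,3)[OF c V(2)]
  assume f: "smooth_near A f (fst z)"
  obtain S where S: "\<phi> (fst z) \<in> S" "S \<subseteq> \<phi> ` U" "smooth_on S (f \<circ> inv_into U \<phi>)"
    using base.smooth_near_chartE[OF f U z(1)] .
  have "open (S \<times> (UNIV :: 'd set))" using smooth_on_open[OF S(3)] by (simp add: open_Times)
  then have "smooth_on (S \<times> (UNIV :: 'd set)) fst"
    by (rule smooth_on_linear[OF bounded_linear_fst smooth_on_ident])
  then have "smooth_on (S \<times> (UNIV :: 'd set)) (\<lambda>e. (f \<circ> inv_into U \<phi>) (fst e))"
    by (rule smooth_on_compose[OF _ S(3)]) auto
  then have "smooth_on (S \<times> UNIV) ((f \<circ> fst) \<circ> inv_into V \<psi>)"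
    by (rule smooth_on_cong) (use S(2) in \<open>auto simp: fst_inv_chart[OF U c] subset_iff\<close>)
  moreover have "S \<times> UNIV \<subseteq> \<psi> ` V" using fibred_chartD(4)[OF c] S(2) by auto
  moreover have "\<psi> z \<in> S \<times> UNIV" using z(2) S(1) by (cases "\<psi> z") auto
  ultimately show "smooth_near B (f \<circ> fst) z" by (intro total.smooth_near_chartI[OF V])
next
  note z = fibred_chartD(2,3)[OF c V(2)]
  assume f: "smooth_near B (f \<circ> fst) z"
  obtain S where S: "\<psi> z \<in> S" "S \<subseteq> \<psi> ` V" "smooth_on S ((f \<circ> fst) \<circ> inv_into V \<psi>)"
    using total.smooth_near_chartE[OF f V] .
  define k where "k = snd (\<psi> z)"
  define S' where "S' = (\<lambda>e. (e, k)) -` S"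
  have op: "open S'"
    unfolding S'_def using smooth_on_open[OF S(3)]
    by (intro open_vimage continuous_intros)
  have S'U: "S' \<subseteq> \<phi> ` U" using S(2) fibred_chartD(4)[OF c] by (auto simp: S'_def)
  have "smooth_on S' (\<lambda>e. (e, k))"
    by (rule smooth_on_Pair[OF smooth_on_ident[OF op] smooth_on_const[OF op]])
  then have "smooth_on S' (\<lambda>e. ((f \<circ> fst) \<circ> inv_into V \<psi>) (e, k))"
    by (rule smooth_on_compose[OF _ S(3)]) (auto simp: S'_def)
  then have "smooth_on S' (f \<circ> inv_into U \<phi>)"
    by (rule smooth_on_cong) (use S'U in \<open>auto simp: fst_inv_chart[OF U c] subset_iff\<close>)
  moreover have "\<phi> (fst z) \<in> S'" using S(1) z(2)[symmetric] by (simp add: S'_def k_def)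
  ultimately show "smooth_near A f (fst z)" using S'U by (intro base.smooth_near_chartI[OF U z(1)])
qed

lemma pushforward_coordinate_vector:
  assumes U: "(U, \<phi>) \<in> A" and V: "(V, \<psi>) \<in> B" "z \<in> V" and c: "fibred_chart (U, \<phi>) (V, \<psi>)"
  shows "pushforward fst (coordinate_vector B (V, \<psi>) z w) = coordinate_vector A (U, \<phi>) (fst z) (fst w)"
proof
  fix f
  note z = fibred_chartD(2,3)[OF c V(2)]
  show "pushforward fst (coordinate_vector B (V, \<psi>) z w) f = coordinate_vector A (U, \<phi>) (fst z) (fst w) f"
  proof (cases "smooth_near A f (fst z)")
    case f: True
    then have ff: "smooth_near B (f \<circ> fst) z" using smooth_near_fst_iff[OF U V c] by blast
    have "frechet_derivative ((f \<circ> fst) \<circ> inv_into V \<psi>) (at (\<psi> z)) =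
        frechet_derivative ((f \<circ> inv_into U \<phi>) \<circ> fst) (at (\<psi> z))"
      by (rule frechet_derivative_cong_open[OF total.open_chart[OF V(1)]])
        (use V(2) fibred_chartD(4)[OF c] fst_inv_chart[OF U c] in auto)
    also have "\<dots> = frechet_derivative (f \<circ> inv_into U \<phi>) (at (fst (\<psi> z))) \<circ> frechet_derivative fst (at (\<psi> z))"
      by (rule frechet_derivative_compose)
        (simp_all add: z(2) base.smooth_near_differentiable[OF f U z(1)]
          bounded_linear_imp_differentiable bounded_linear_fst)
    also have "frechet_derivative fst (at (\<psi> z)) = (fst :: 'e \<times> 'd \<Rightarrow> 'e)"
      using bounded_linear_imp_has_derivative[OF bounded_linear_fst] frechet_derivative_at by metis
    finally show ?thesis
      unfolding pushforward_def base.coordinate_vector_smooth[OF f]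
        total.coordinate_vector_smooth[OF ff] z(2) by (rule fun_cong[THEN trans]) (rule o_apply)
  next
    case False
    then have "\<not> smooth_near B (f \<circ> fst) z" using smooth_near_fst_iff[OF U V c] by blast
    then show ?thesis
      using False by (simp add: pushforward_def coordinate_vector_def)
  qed
qed

text \<open>Forms on the base are controlled on tangent vectors only, so every evaluation of a
  pullback on a tangent vector depends on this.\<close>

lemma pushforward_tangent:
  assumes "v \<in> tangent_space B z"
  shows "pushforward fst v \<in> tangent_space A (fst z)"
proof -
  obtain V \<psi> w where V: "(V, \<psi>) \<in> B" "z \<in> V" and w: "v = coordinate_vector B (V, \<psi>) z w"
    using total.tangent_space_chartE[OF assms] .
  obtain U \<phi> where U: "(U, \<phi>) \<in> A" and c: "fibred_chart (U, \<phi>) (V, \<psi>)" using fibredE[OF V(1)] .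
  show ?thesis
    unfolding w pushforward_coordinate_vector[OF U V c]
    by (rule base.coordinate_vector_in_tangent_space[OF U fibred_chartD(2)[OF c V(2)]])
qed

lemma smooth_near_fst:
  assumes "smooth_near A f (fst z)" "z \<in> points B"
  shows "smooth_near B (f \<circ> fst) z"
proof -
  obtain V \<psi> where V: "(V, \<psi>) \<in> B" "z \<in> V" using total.points_chartE[OF assms(2)] .
  obtain U \<phi> where U: "(U, \<phi>) \<in> A" and c: "fibred_chart (U, \<phi>) (V, \<psi>)" using fibredE[OF V(1)] .
  show ?thesis using smooth_near_fst_iff[OF U V c] assms(1) by blast
qed

lemma form_on_pullback:
  assumes L: "base.form_on U \<omega> L" and V: "(V, \<psi>) \<in> B" and c: "fibred_chart (U, \<phi>) (V, \<psi>)"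
  shows "total.form_on V (pullback fst \<omega>) (map (\<lambda>a. (fst a \<circ> fst, snd a \<circ> fst)) L)"
  unfolding total.form_on_def
proof (intro ballI conjI)
  fix z a assume z: "z \<in> V" and "a \<in> set (map (\<lambda>a. (fst a \<circ> (fst :: 'm \<times> 'k \<Rightarrow> 'm), snd a \<circ> (fst :: 'm \<times> 'k \<Rightarrow> 'm))) L)"
  then obtain a' where a': "a' \<in> set L" and a: "a = (fst a' \<circ> fst, snd a' \<circ> fst)" by auto
  show "smooth_near B (fst a) z" "smooth_near B (snd a) z"
    unfolding a fst_conv snd_conv
    using base.form_onD(1,2)[OF L fibred_chartD(2)[OF c z] a'] total.points_chartI[OF V z]
    by (auto intro: smooth_near_fst)
next
  fix z v assume z: "z \<in> V" and v: "v \<in> tangent_space B z"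
  show "pullback fst \<omega> z v = (\<Sum>a\<leftarrow>map (\<lambda>a. (fst a \<circ> fst, snd a \<circ> fst)) L. fst a z * v (snd a))"
    using base.form_onD(3)[OF L fibred_chartD(2)[OF c z] pushforward_tangent[OF v]]
    by (simp add: pullback_def pushforward_def o_def)
qed

end

context smooth_atlas
begin

section \<open>Product with the line and its time slices\<close>

lemma times_line_chartE:
  assumes "(V, \<psi>) \<in> times_line A"
  obtains U \<phi> where "(U, \<phi>) \<in> A" "V = U \<times> UNIV" "\<psi> = map_prod \<phi> id"
  using assms unfolding times_line_def by auto

lemma times_line_chartI: "(U, \<phi>) \<in> A \<Longrightarrow> (U \<times> UNIV, map_prod \<phi> id) \<in> times_line A"
  unfolding times_line_def by force

lemma points_times_line: "points (times_line A) = points A \<times> UNIV"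
  unfolding points_def times_line_def by auto

lemma inv_times_line_chart:
  fixes s :: real
  assumes U: "(U, \<phi>) \<in> A" and e: "e \<in> \<phi> ` U"
  shows "inv_into (U \<times> UNIV) (map_prod \<phi> id) (e, s) = (inv_into U \<phi> e, s)"
proof -
  have "inj_on (map_prod \<phi> (id :: real \<Rightarrow> real)) (U \<times> UNIV)"
    using map_prod_inj_on[OF inj_chart[OF U] inj_on_id] .
  moreover have "map_prod \<phi> id (inv_into U \<phi> e, s) = (e, s)" using e by (simp add: f_inv_into_f)
  moreover have "(inv_into U \<phi> e, s) \<in> U \<times> UNIV" using e by (simp add: inv_into_into)
  ultimately show ?thesis by (intro inv_into_f_eq)
qed

lemma smooth_atlas_times_line: "smooth_atlas (times_line A)"
proof
  fix V \<psi> assume V: "(V, \<psi>) \<in> times_line A"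
  obtain U \<phi> where U: "(U, \<phi>) \<in> A" "V = U \<times> UNIV" "\<psi> = map_prod \<phi> id" using times_line_chartE[OF V] .
  show "inj_on \<psi> V" unfolding U(2,3) using map_prod_inj_on[OF inj_chart[OF U(1)] inj_on_id] .
  have im: "map_prod \<phi> id ` (W \<times> UNIV) = (\<phi> ` W) \<times> (UNIV :: real set)" for W
    by (simp add: map_prod_surj_on)
  show "open (\<psi> ` V)" unfolding U(2,3) im using open_chart[OF U(1)] by (simp add: open_Times)
  fix V' \<psi>' assume V': "(V', \<psi>') \<in> times_line A"
  obtain U' \<phi>' where U': "(U', \<phi>') \<in> A" "V' = U' \<times> UNIV" "\<psi>' = map_prod \<phi>' id"
    using times_line_chartE[OF V'] .
  define \<tau> where "\<tau> = \<phi>' \<circ> inv_into U \<phi>"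
  have \<tau>: "smooth_on (\<phi> ` (U \<inter> U')) \<tau>" unfolding \<tau>_def by (rule transition[OF U(1) U'(1)])
  define W where "W = \<phi> ` (U \<inter> U') \<times> (UNIV :: real set)"
  have op: "open W" unfolding W_def using smooth_on_open[OF \<tau>] by (simp add: open_Times)
  have "smooth_on W fst" "smooth_on W snd"
    using smooth_on_linear[OF bounded_linear_fst smooth_on_ident[OF op]]
      smooth_on_linear[OF bounded_linear_snd smooth_on_ident[OF op]] by simp_all
  then have "smooth_on W (\<lambda>e. (\<tau> (fst e), snd e))"
    by (intro smooth_on_Pair) (rule smooth_on_compose[OF _ \<tau>], auto simp: W_def)
  then have "smooth_on W (\<psi>' \<circ> inv_into V \<psi>)"
    by (rule smooth_on_cong) (auto simp: W_def U(2,3) U'(3) \<tau>_def inv_times_line_chart[OF U(1)])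
  moreover have "V \<inter> V' = (U \<inter> U') \<times> UNIV" using U U' by auto
  ultimately show "smooth_on (\<psi> ` (V \<inter> V')) (\<psi>' \<circ> inv_into V \<psi>)"
    unfolding W_def U(3) by (simp add: im)
qed

lemma fibred_times_line_chart:
  "(U, \<phi>) \<in> A \<Longrightarrow> fibred_chart (U, \<phi>) (U \<times> UNIV, map_prod \<phi> (id :: real \<Rightarrow> real))"
  unfolding fibred_chart_def using map_prod_inj_on[OF inj_chart inj_on_id]
  by (auto simp: map_prod_surj_on)

lemma fibration_times_line: "fibration A (times_line A)"
proof (intro fibration.intro fibration_axioms.intro)
  show "smooth_atlas A" by (rule smooth_atlas_axioms)
  show "smooth_atlas (times_line A)" by (rule smooth_atlas_times_line)
  fix V \<psi> assume "(V, \<psi>) \<in> times_line A"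
  then obtain U \<phi> where U: "(U, \<phi>) \<in> A" "V = U \<times> UNIV" "\<psi> = map_prod \<phi> id"
    by (rule times_line_chartE)
  show "\<exists>c\<in>A. fibred_chart c (V, \<psi>)"
    unfolding U(2,3) by (intro bexI[of _ "(U, \<phi>)"] fibred_times_line_chart U(1))
qed

lemma smooth_near_slice:
  assumes f: "smooth_near (times_line A) f (y, s)" and U: "(U, \<phi>) \<in> A" "y \<in> U"
  shows "smooth_near A (\<lambda>z. f (z, s)) y"
proof -
  interpret T: fibration A "times_line A" by (rule fibration_times_line)
  have ys: "(y, s) \<in> U \<times> UNIV" using U(2) by simp
  obtain S where S: "map_prod \<phi> id (y, s) \<in> S" "S \<subseteq> map_prod \<phi> id ` (U \<times> UNIV)"
    "smooth_on S (f \<circ> inv_into (U \<times> UNIV) (map_prod \<phi> id))"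
    using T.total.smooth_near_chartE[OF f times_line_chartI[OF U(1)] ys] .
  define S' where "S' = (\<lambda>e. (e, s)) -` S"
  have op: "open S'"
    unfolding S'_def using smooth_on_open[OF S(3)] by (intro open_vimage continuous_intros)
  have S'U: "S' \<subseteq> \<phi> ` U" using S(2) by (auto simp: S'_def)
  have "smooth_on S' (\<lambda>e. (e, s))"
    by (rule smooth_on_Pair[OF smooth_on_ident[OF op] smooth_on_const[OF op]])
  then have "smooth_on S' (\<lambda>e. (f \<circ> inv_into (U \<times> UNIV) (map_prod \<phi> id)) (e, s))"
    by (rule smooth_on_compose[OF _ S(3)]) (auto simp: S'_def)
  then have "smooth_on S' ((\<lambda>z. f (z, s)) \<circ> inv_into U \<phi>)"
    by (rule smooth_on_cong) (use S'U in \<open>auto simp: inv_times_line_chart[OF U(1)] subset_iff\<close>)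
  then show ?thesis
    using S(1) S'U by (intro smooth_near_chartI[OF U, of S']) (auto simp: S'_def)
qed

lemma smooth_near_snd:
  assumes "x \<in> points (times_line A)"
  shows "smooth_near (times_line A) snd x"
proof -
  interpret T: fibration A "times_line A" by (rule fibration_times_line)
  obtain V \<psi> where V: "(V, \<psi>) \<in> times_line A" "x \<in> V" using T.total.points_chartE[OF assms] .
  obtain U \<phi> where U: "(U, \<phi>) \<in> A" "V = U \<times> UNIV" "\<psi> = map_prod \<phi> id"
    using V(1) by (rule times_line_chartE)
  have "(\<lambda>y. \<psi> y \<bullet> (0, 1)) = snd" unfolding U(3) by (auto simp: fun_eq_iff)
  then show ?thesis using T.total.smooth_near_coordinate[OF V, of "(0, 1)"] by simp
qed

text \<open>Trades the one-variable \<open>deriv\<close> for a coordinate vector, so that the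
  general facts on coordinate vectors show \<open>line_field\<close> to be tangent and
  smooth.\<close>

lemma line_field_coordinate_vector:
  assumes U: "(U, \<phi>) \<in> A" "y \<in> U"
  shows "line_field (times_line A) (y, s) =
    coordinate_vector (times_line A) (U \<times> UNIV, map_prod \<phi> id) (y, s) (0, 1)"
proof
  fix f
  interpret T: fibration A "times_line A" by (rule fibration_times_line)
  have ys: "(y, s) \<in> U \<times> UNIV" using U(2) by simp
  show "line_field (times_line A) (y, s) f =
    coordinate_vector (times_line A) (U \<times> UNIV, map_prod \<phi> id) (y, s) (0, 1) f"
  proof (cases "smooth_near (times_line A) f (y, s)")
    case True
    define F where "F = f \<circ> inv_into (U \<times> UNIV) (map_prod \<phi> (id :: real \<Rightarrow> real))"
    define D where "D = frechet_derivative F (at (\<phi> y, s))"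
    have "(F has_derivative D) (at (\<phi> y, s))"
      using has_frechet_derivative[OF T.total.smooth_near_differentiable[OF True times_line_chartI[OF U(1)] ys]]
      by (simp add: F_def D_def)
    moreover have "((\<lambda>r. (\<phi> y, r)) has_derivative (\<lambda>r. (0, r))) (at s)"
      by (auto intro!: derivative_eq_intros)
    ultimately have "((\<lambda>r. F (\<phi> y, r)) has_derivative (\<lambda>r. D (0, r))) (at s)"
      using diff_chain_at[of "\<lambda>r. (\<phi> y, r)" "\<lambda>r. (0, r)" s F D] by (simp add: o_def)
    moreover have "(\<lambda>r. F (\<phi> y, r)) = (\<lambda>r. f (y, r))"
      using U by (simp add: F_def inv_times_line_chart[OF U(1)] inv_chart[OF U(1)])
    moreover have "(\<lambda>r. D (0, r)) = (*) (D (0, 1))"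
    proof
      fix r :: real
      have "linear D" using \<open>(F has_derivative D) (at (\<phi> y, s))\<close> by (rule has_derivative_linear)
      then have "D (r *\<^sub>R (0, 1)) = r *\<^sub>R D (0, 1)" by (rule linear_cmul)
      then show "D (0, r) = D (0, 1) * r" by (simp add: mult.commute)
    qed
    ultimately have "((\<lambda>r. f (y, r)) has_real_derivative D (0, 1)) (at s)"
      unfolding has_field_derivative_def by simp
    then have "deriv (\<lambda>r. f (y, r)) s = D (0, 1)" by (rule DERIV_imp_deriv)
    then show ?thesis
      using True by (simp add: line_field_def coordinate_vector_def D_def F_def)
  next
    case False
    then show ?thesis by (simp add: line_field_def coordinate_vector_def)
  qed
qed

lemma line_field_fst: "line_field (times_line A) (y, s) (f \<circ> fst) = 0"
  by (simp add: line_field_def)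

lemma line_field_snd: "x \<in> points (times_line A) \<Longrightarrow> line_field (times_line A) x snd = 1"
  using smooth_near_snd[of x] by (cases x) (simp add: line_field_def)

lemma smooth_line_field: "smooth_vector_field (times_line A) (line_field (times_line A))"
  unfolding smooth_vector_field_def
proof (intro ballI conjI allI impI)
  interpret T: fibration A "times_line A" by (rule fibration_times_line)
  fix x assume "x \<in> points (times_line A)"
  then obtain V \<psi> where V: "(V, \<psi>) \<in> times_line A" "x \<in> V" by (rule T.total.points_chartE)
  obtain U \<phi> where U: "(U, \<phi>) \<in> A" "V = U \<times> UNIV" "\<psi> = map_prod \<phi> id"
    using V(1) by (rule times_line_chartE)
  have eq: "line_field (times_line A) z = coordinate_vector (times_line A) (V, \<psi>) z (0, 1)" if "z \<in> V" for z
    using line_field_coordinate_vector[OF U(1), of "fst z" "snd z"] that unfolding U(2,3) by auto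
  show "line_field (times_line A) x \<in> tangent_space (times_line A) x"
    unfolding eq[OF V(2)] by (rule T.total.coordinate_vector_in_tangent_space[OF V])
  fix f assume f: "smooth_near (times_line A) f x"
  show "smooth_near (times_line A) (\<lambda>z. line_field (times_line A) z f) x"
    by (rule T.total.smooth_near_cong[OF V open_UNIV UNIV_I _
          T.total.smooth_near_coordinate_vector[OF V f, of "(0, 1)"]]) (simp add: eq)
qed

text \<open>In coordinates \<open>w = (fst w, 0) + snd w *\<^sub>R (0, 1)\<close>. This is what
  splits the derivative of the time-dependent \<open>h\<close> into its slice part and its part
  along \<open>\<partial>\<^sub>t\<close>.\<close>

lemma tangent_times_line_split:
  assumes v: "v \<in> tangent_space (times_line A) (y, s)" and f: "smooth_near (times_line A) f (y, s)"
  shows "v f = pushforward fst v (\<lambda>z. f (z, s)) + v snd * line_field (times_line A) (y, s) f"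
proof -
  interpret T: fibration A "times_line A" by (rule fibration_times_line)
  obtain V \<psi> w where V: "(V, \<psi>) \<in> times_line A" "(y, s) \<in> V"
    and w: "v = coordinate_vector (times_line A) (V, \<psi>) (y, s) w"
    using T.total.tangent_space_chartE[OF v] .
  obtain U \<phi> where U: "(U, \<phi>) \<in> A" "V = U \<times> UNIV" "\<psi> = map_prod \<phi> id"
    using V(1) by (rule times_line_chartE)
  have y: "y \<in> U" using V(2) U(2) by simp
  define F where "F = f \<circ> inv_into V \<psi>"
  define D where "D = frechet_derivative F (at (\<phi> y, s))"
  have \<psi>: "\<psi> (y, s) = (\<phi> y, s)" by (simp add: U(3))
  have F: "(F has_derivative D) (at (\<phi> y, s))"
    using has_frechet_derivative[OF T.total.smooth_near_differentiable[OF f V]]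
    by (simp add: F_def D_def \<psi>)
  have lin: "linear D" using F by (rule has_derivative_linear)
  have 1: "v f = D w" unfolding w T.total.coordinate_vector_smooth[OF f] \<psi> by (simp add: F_def D_def)
  have "(\<lambda>z. \<psi> z \<bullet> (0, 1)) = snd" unfolding U(3) by (auto simp: fun_eq_iff)
  then have 2: "v snd = snd w"
    using T.total.coordinate_vector_coordinate[OF V, of w "(0, 1)"] w by (cases w) simp
  have 3: "line_field (times_line A) (y, s) f = D (0, 1)"
    unfolding line_field_coordinate_vector[OF U(1) y] using f
    by (simp add: coordinate_vector_def F_def D_def U(2,3))
  have "fibred_chart (U, \<phi>) (V, \<psi>)" unfolding U(2,3) by (rule fibred_times_line_chart[OF U(1)])
  then have "pushforward fst v = coordinate_vector A (U, \<phi>) y (fst w)"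
    using T.pushforward_coordinate_vector[OF U(1) V] w by simp
  moreover have "coordinate_vector A (U, \<phi>) y (fst w) (\<lambda>z. f (z, s)) = D (fst w, 0)"
  proof -
    have d: "((\<lambda>e. (e, s)) has_derivative (\<lambda>e. (e, 0))) (at (\<phi> y))"
      by (auto intro!: derivative_eq_intros)
    have "((F \<circ> (\<lambda>e. (e, s))) has_derivative (D \<circ> (\<lambda>e. (e, 0)))) (at (\<phi> y))"
      using diff_chain_at[OF d] F by blast
    then have "D \<circ> (\<lambda>e. (e, 0)) = frechet_derivative (F \<circ> (\<lambda>e. (e, s))) (at (\<phi> y))"
      by (rule frechet_derivative_at)
    also have "\<dots> = frechet_derivative ((\<lambda>z. f (z, s)) \<circ> inv_into U \<phi>) (at (\<phi> y))"
      by (rule frechet_derivative_cong_open[OF open_chart[OF U(1)]])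
        (use y in \<open>auto simp: F_def U(2,3) inv_times_line_chart[OF U(1)]\<close>)
    finally show ?thesis
      using coordinate_vector_smooth[OF smooth_near_slice[OF f U(1) y], of U \<phi> "fst w"]
        fun_cong[of "D \<circ> (\<lambda>e. (e, 0))"] by (metis o_apply)
  qed
  moreover have "D w = D (fst w, 0) + snd w * D (0, 1)"
  proof -
    have "w = (fst w, 0) + snd w *\<^sub>R (0, 1)" by (cases w) simp
    then have "D w = D (fst w, 0) + D (snd w *\<^sub>R (0, 1))" using linear_add[OF lin] by metis
    then show ?thesis unfolding linear_cmul[OF lin] real_scaleR_def .
  qed
  ultimately show ?thesis using 1 2 3 by simp
qed

text \<open>Makes the slices of \<open>X\<close> and \<open>Y\<close> admissible test fields in the
  defining equation of \<open>X\<close>. For smoothness, \<open>Y\<close> is applied to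
  \<open>f \<circ> fst\<close> on the product and the result is restricted to the slice.\<close>

lemma smooth_slice_field:
  assumes Y: "smooth_vector_field (times_line A) Y"
  shows "smooth_vector_field A (slice_field s Y)"
  unfolding smooth_vector_field_def
proof (intro ballI conjI allI impI)
  interpret T: fibration A "times_line A" by (rule fibration_times_line)
  fix x assume x: "x \<in> points A"
  then have xs: "(x, s) \<in> points (times_line A)" by (simp add: points_times_line)
  show "slice_field s Y x \<in> tangent_space A x"
    using T.pushforward_tangent[OF T.total.smooth_vector_fieldD(1)[OF Y xs]]
    by (simp add: slice_field_def)
  fix f assume f: "smooth_near A f x"
  obtain U \<phi> where U: "(U, \<phi>) \<in> A" "x \<in> U" using points_chartE[OF x] .
  have "smooth_near (times_line A) (f \<circ> fst) (x, s)"
    using f xs by (intro T.smooth_near_fst) auto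
  from smooth_near_slice[OF T.total.smooth_vector_fieldD(2)[OF Y xs this] U]
  show "smooth_near A (\<lambda>y. slice_field s Y y f) x"
    by (simp add: slice_field_def pushforward_def)
qed

section \<open>The cotangent bundle and the Liouville form\<close>

text \<open>By linearity a covector acts as the inner product with its momentum vector. Injectivity
  of the cotangent charts, their transition maps and the expression \<open>p dq\<close> all follow
  from this.\<close>

lemma cotangent_linear:
  assumes p: "p \<in> cotangent_space A x" and U: "(U, \<phi>) \<in> A" "x \<in> U"
  shows "p (coordinate_vector A (U, \<phi>) x w) =
    w \<bullet> (\<Sum>b\<in>Basis. p (coordinate_vector A (U, \<phi>) x b) *\<^sub>R b)"
proof -
  define l where "l w = p (coordinate_vector A (U, \<phi>) x w)" for w
  have l: "l (a *\<^sub>R w + b *\<^sub>R w') = a * l w + b * l w'" for a b w w'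
    unfolding l_def coordinate_vector_linear[OF U]
    using p coordinate_vector_in_tangent_space[OF U] unfolding cotangent_space_def by blast
  have "linear l"
    by (rule linearI) (use l[of 1 _ 1] l[of _ _ 0 0] in auto)
  then have "l (\<Sum>b\<in>Basis. (w \<bullet> b) *\<^sub>R b) = (\<Sum>b\<in>Basis. (w \<bullet> b) * l b)"
    by (simp add: linear_sum linear_cmul)
  then show ?thesis
    by (simp add: l_def[symmetric] euclidean_representation inner_sum_right mult.commute)
qed

definition cotangent_coordinates :: "'m set \<Rightarrow> ('m \<Rightarrow> 'e) \<Rightarrow> 'm \<times> 'm cotangent \<Rightarrow> 'e \<times> 'e" where
  "cotangent_coordinates U \<phi> =
     (\<lambda>(x, p). (\<phi> x, \<Sum>b\<in>Basis. p (coordinate_vector A (U, \<phi>) x b) *\<^sub>R b))"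

lemma cotangent_chart_eq:
  "cotangent_chart A (U, \<phi>) = (Sigma U (cotangent_space A), cotangent_coordinates U \<phi>)"
  by (simp add: cotangent_chart_def cotangent_coordinates_def)

lemma cotangent_bundle_chartE:
  assumes "(V, \<psi>) \<in> cotangent_bundle A"
  obtains U \<phi> where "(U, \<phi>) \<in> A" "V = Sigma U (cotangent_space A)" "\<psi> = cotangent_coordinates U \<phi>"
proof -
  obtain c where c: "c \<in> A" "(V, \<psi>) = cotangent_chart A c"
    using assms unfolding cotangent_bundle_def by (rule imageE) blast
  obtain U \<phi> where U: "c = (U, \<phi>)" by (cases c)
  show ?thesis
    using that[of U \<phi>] c unfolding U cotangent_chart_eq prod.inject by blast
qed

text \<open>The momenta determine a covector on tangent vectors; on all other operators both
  covectors are 0 by convention, so they are equal as functions.\<close>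

lemma inj_cotangent_coordinates:
  assumes U: "(U, \<phi>) \<in> A"
  shows "inj_on (cotangent_coordinates U \<phi>) (Sigma U (cotangent_space A))"
proof (rule inj_onI)
  fix z z'
  assume z: "z \<in> Sigma U (cotangent_space A)" "z' \<in> Sigma U (cotangent_space A)"
    and zz': "cotangent_coordinates U \<phi> z = cotangent_coordinates U \<phi> z'"
  obtain x p where xp: "z = (x, p)" by (cases z)
  obtain x' p' where xp': "z' = (x', p')" by (cases z')
  have x: "x \<in> U" "x' \<in> U" and p: "p \<in> cotangent_space A x" "p' \<in> cotangent_space A x'"
    using z unfolding xp xp' by auto
  have \<phi>: "\<phi> x = \<phi> x'"
    and eq: "(\<Sum>b\<in>Basis. p (coordinate_vector A (U, \<phi>) x b) *\<^sub>R b) =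
      (\<Sum>b\<in>Basis. p' (coordinate_vector A (U, \<phi>) x' b) *\<^sub>R b)"
    using zz' unfolding cotangent_coordinates_def xp xp' prod.case prod.inject by blast+
  have xx: "x = x'" using inj_onD[OF inj_chart[OF U] \<phi> x] .
  have "p v = p' v" for v
  proof (cases "v \<in> tangent_space A x")
    case True
    obtain w where w: "v = coordinate_vector A (U, \<phi>) x w" using tangent_in_chart[OF True U x(1)] .
    show ?thesis
      using cotangent_linear[OF p(1) U x(1), of w] cotangent_linear[OF p(2) U x(2), of w]
      unfolding w eq by (simp only: xx)
  next
    case False
    then have "p v = 0" "p' v = 0" using p by (simp_all add: cotangent_space_def xx)
    then show ?thesis by simp
  qed
  then show "z = z'" unfolding xp xp' xx by blast
qed

lemma cotangent_coordinates_image: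
  assumes U: "(U, \<phi>) \<in> A" and W: "W \<subseteq> U"
  shows "cotangent_coordinates U \<phi> ` Sigma W (cotangent_space A) = \<phi> ` W \<times> UNIV"
proof
  show "cotangent_coordinates U \<phi> ` Sigma W (cotangent_space A) \<subseteq> \<phi> ` W \<times> UNIV"
    by (auto simp: cotangent_coordinates_def)
  show "\<phi> ` W \<times> UNIV \<subseteq> cotangent_coordinates U \<phi> ` Sigma W (cotangent_space A)"
  proof clarsimp
    fix x \<epsilon> assume "x \<in> W"
    then have x: "x \<in> U" using W by blast
    \<comment> \<open>The covector with momentum \<open>\<epsilon>\<close>. It reads the components
      of \<open>v\<close> by applying \<open>v\<close> to the coordinate functions, which makes
      linearity immediate without choosing a representing vector.\<close>
    define p where "p v = (if v \<in> tangent_space A x then \<Sum>b\<in>Basis. v (\<lambda>y. \<phi> y \<bullet> b) * (\<epsilon> \<bullet> b) else 0)" for v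
    have "p \<in> cotangent_space A x"
      unfolding cotangent_space_def
      by (auto simp: p_def tangent_space_linear sum.distrib sum_distrib_left algebra_simps)
    moreover have "cotangent_coordinates U \<phi> (x, p) = (\<phi> x, \<epsilon>)"
    proof -
      have "p (coordinate_vector A (U, \<phi>) x b) = \<epsilon> \<bullet> b" if "b \<in> Basis" for b
        using that coordinate_vector_in_tangent_space[OF U x]
        by (simp add: p_def coordinate_vector_coordinate[OF U x] inner_Basis if_distrib[of "\<lambda>c. c * _"]
            cong: if_cong)
      then show ?thesis by (simp add: cotangent_coordinates_def euclidean_representation)
    qed
    ultimately show "(\<phi> x, \<epsilon>) \<in> cotangent_coordinates U \<phi> ` Sigma W (cotangent_space A)"
      using \<open>x \<in> W\<close> by (metis (no_types, lifting) SigmaI image_eqI)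
  qed
qed

lemma smooth_atlas_cotangent_bundle: "smooth_atlas (cotangent_bundle A)"
proof
  fix V \<psi> assume V: "(V, \<psi>) \<in> cotangent_bundle A"
  obtain U \<phi> where U: "(U, \<phi>) \<in> A" "V = Sigma U (cotangent_space A)" "\<psi> = cotangent_coordinates U \<phi>"
    using V by (rule cotangent_bundle_chartE)
  show inj: "inj_on \<psi> V" unfolding U(2,3) by (rule inj_cotangent_coordinates[OF U(1)])
  show "open (\<psi> ` V)"
    unfolding U(2,3) cotangent_coordinates_image[OF U(1) order_refl] using open_chart[OF U(1)]
    by (simp add: open_Times)
  fix V' \<psi>' assume V': "(V', \<psi>') \<in> cotangent_bundle A"
  obtain U' \<phi>' where U': "(U', \<phi>') \<in> A" "V' = Sigma U' (cotangent_space A)" "\<psi>' = cotangent_coordinates U' \<phi>'"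
    using V' by (rule cotangent_bundle_chartE)
  define \<tau> where "\<tau> = \<phi>' \<circ> inv_into U \<phi>"
  \<comment> \<open>Momenta transform by the transpose of the derivative of the inverse coordinate
    change: a new basis vector \<open>b\<close> has old components
    \<open>frechet_derivative \<sigma> (at (\<phi>' x)) b\<close>, so its new momentum is their
    inner product with the old momentum vector.\<close>
  define \<sigma> where "\<sigma> = \<phi> \<circ> inv_into U' \<phi>'"
  have \<tau>: "smooth_on (\<phi> ` (U \<inter> U')) \<tau>" unfolding \<tau>_def by (rule transition[OF U(1) U'(1)])
  have \<sigma>: "smooth_on (\<phi>' ` (U \<inter> U')) \<sigma>"
    unfolding \<sigma>_def using transition[OF U'(1) U(1)] by (simp add: Int_commute)
  define W where "W = \<phi> ` (U \<inter> U') \<times> (UNIV :: 'e set)"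
  have op: "open W" unfolding W_def using smooth_on_open[OF \<tau>] by (simp add: open_Times)
  have fst: "smooth_on W fst" and snd: "smooth_on W snd"
    using smooth_on_linear[OF bounded_linear_fst smooth_on_ident[OF op]]
      smooth_on_linear[OF bounded_linear_snd smooth_on_ident[OF op]] by simp_all
  have \<tau>fst: "smooth_on W (\<lambda>e. \<tau> (fst e))"
    by (rule smooth_on_compose[OF fst \<tau>]) (auto simp: W_def)
  have "smooth_on W (\<lambda>e. frechet_derivative \<sigma> (at (\<tau> (fst e))) b)" for b
    by (rule smooth_on_compose[OF \<tau>fst smooth_on_derivative[OF \<sigma>]])
      (auto simp: W_def \<tau>_def inv_chart[OF U(1)])
  then have "smooth_on W (\<lambda>e. \<Sum>b\<in>Basis. (frechet_derivative \<sigma> (at (\<tau> (fst e))) b \<bullet> snd e) *\<^sub>R b)"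
    by (intro smooth_on_sum op) (rule smooth_on_scaleR[OF smooth_on_inner[OF _ snd] smooth_on_const[OF op]])
  then have sm: "smooth_on W (\<lambda>e. (\<tau> (fst e),
      \<Sum>b\<in>Basis. (frechet_derivative \<sigma> (at (\<tau> (fst e))) b \<bullet> snd e) *\<^sub>R b))"
    by (rule smooth_on_Pair[OF \<tau>fst])
  have "V \<inter> V' = Sigma (U \<inter> U') (cotangent_space A)" using U U' by auto
  then have im: "\<psi> ` (V \<inter> V') = W"
    unfolding W_def U(3) by (simp add: cotangent_coordinates_image[OF U(1)])
  show "smooth_on (\<psi> ` (V \<inter> V')) (\<psi>' \<circ> inv_into V \<psi>)"
    unfolding im
  proof (rule smooth_on_cong[OF sm])
    fix e assume "e \<in> W"
    then obtain x p where z: "(x, p) \<in> V" "(x, p) \<in> V'" and e: "e = \<psi> (x, p)" unfolding im[symmetric] by auto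
    have x: "x \<in> U" "x \<in> U'" and p: "p \<in> cotangent_space A x" using z U U' by auto
    have "inv_into V \<psi> e = (x, p)" using inj z(1) by (simp add: e)
    moreover have fe: "fst e = \<phi> x" and se: "snd e = (\<Sum>b\<in>Basis. p (coordinate_vector A (U, \<phi>) x b) *\<^sub>R b)"
      by (simp_all add: e U(3) cotangent_coordinates_def)
    moreover have "\<tau> (\<phi> x) = \<phi>' x" by (simp add: \<tau>_def inv_chart[OF U(1) x(1)])
    moreover have "p (coordinate_vector A (U', \<phi>') x b) = frechet_derivative \<sigma> (at (\<phi>' x)) b \<bullet> snd e" for b
      unfolding coordinate_vector_transition[OF U(1) x(1) U'(1) x(2)] \<sigma>_def[symmetric] se
      by (rule cotangent_linear[OF p U(1) x(1)])
    ultimately show "(\<tau> (fst e), \<Sum>b\<in>Basis. (frechet_derivative \<sigma> (at (\<tau> (fst e))) b \<bullet> snd e) *\<^sub>R b) =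
        (\<psi>' \<circ> inv_into V \<psi>) e"
      by (simp add: U'(3) cotangent_coordinates_def)
  qed
qed

lemma fibred_cotangent_chart:
  assumes U: "(U, \<phi>) \<in> A"
  shows "fibred_chart (U, \<phi>) (Sigma U (cotangent_space A), cotangent_coordinates U \<phi>)"
  unfolding fibred_chart_def
  using inj_cotangent_coordinates[OF U] cotangent_coordinates_image[OF U order_refl]
  by (auto simp: cotangent_coordinates_def)

lemma fibration_cotangent_bundle: "fibration A (cotangent_bundle A)"
proof (intro fibration.intro fibration_axioms.intro)
  show "smooth_atlas A" by (rule smooth_atlas_axioms)
  show "smooth_atlas (cotangent_bundle A)" by (rule smooth_atlas_cotangent_bundle)
  fix V \<psi> assume "(V, \<psi>) \<in> cotangent_bundle A"
  then obtain U \<phi> where U: "(U, \<phi>) \<in> A" "V = Sigma U (cotangent_space A)" "\<psi> = cotangent_coordinates U \<phi>"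
    by (rule cotangent_bundle_chartE)
  show "\<exists>c\<in>A. fibred_chart c (V, \<psi>)"
    unfolding U(2,3) by (intro bexI[of _ "(U, \<phi>)"] fibred_cotangent_chart U(1))
qed

text \<open>On each cotangent chart the list \<open>L\<close> is the classical expression
  \<open>\<Sum> p dq\<close>; the basis is enumerated because local expressions are lists.\<close>

lemma smooth_liouville_form: "smooth_atlas.smooth_one_form (cotangent_bundle A) liouville_form"
proof -
  interpret C: fibration A "cotangent_bundle A" by (rule fibration_cotangent_bundle)
  obtain bs :: "'e list" where bs: "set bs = Basis" "distinct bs"
    using finite_distinct_list[OF finite_Basis] by blast
  show ?thesis
    unfolding C.total.smooth_one_form_def
  proof clarify
    fix V \<psi> assume V: "(V, \<psi>) \<in> cotangent_bundle A"
    obtain U \<phi> where U: "(U, \<phi>) \<in> A" "V = Sigma U (cotangent_space A)" "\<psi> = cotangent_coordinates U \<phi>"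
      using V by (rule cotangent_bundle_chartE)
    have c: "fibred_chart (U, \<phi>) (V, \<psi>)" unfolding U(2,3) by (rule fibred_cotangent_chart[OF U(1)])
    define L where "L = map (\<lambda>b. (\<lambda>z. snd (\<psi> z) \<bullet> b, (\<lambda>x. \<phi> x \<bullet> b) \<circ> (fst :: 'm \<times> 'm cotangent \<Rightarrow> 'm))) bs"
    have "C.total.form_on V liouville_form L"
      unfolding C.total.form_on_def
    proof (intro ballI conjI)
      fix z a assume z: "z \<in> V" and "a \<in> set L"
      then obtain b where a: "a = (\<lambda>z. snd (\<psi> z) \<bullet> b, (\<lambda>x. \<phi> x \<bullet> b) \<circ> fst)" by (auto simp: L_def)
      have "(\<lambda>z. snd (\<psi> z) \<bullet> b) = (\<lambda>z. \<psi> z \<bullet> (0, b))" by (simp add: inner_prod_def)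
      then show "smooth_near (cotangent_bundle A) (fst a) z"
        unfolding a fst_conv using C.total.smooth_near_coordinate[OF V z, of "(0, b)"] by simp
      show "smooth_near (cotangent_bundle A) (snd a) z"
        unfolding a snd_conv
        by (rule C.smooth_near_fst[OF smooth_near_coordinate[OF U(1) C.fibred_chartD(2)[OF c z]]
              C.total.points_chartI[OF V z]])
    next
      fix z v assume z: "z \<in> V" and v: "v \<in> tangent_space (cotangent_bundle A) z"
      obtain x p where xp: "z = (x, p)" by (cases z)
      have x: "x \<in> U" and p: "p \<in> cotangent_space A x" using z U(2) xp by auto
      define w where "w = (\<Sum>b\<in>Basis. pushforward fst v (\<lambda>y. \<phi> y \<bullet> b) *\<^sub>R b)"
      have pv: "pushforward fst v = coordinate_vector A (U, \<phi>) x w"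
        unfolding w_def using C.pushforward_tangent[OF v] xp by (intro tangent_coordinates U x) simp
      have "liouville_form z v = p (pushforward fst v)" by (simp add: liouville_form_def xp)
      also have "\<dots> = w \<bullet> snd (\<psi> z)"
        unfolding pv xp U(3) cotangent_coordinates_def prod.case snd_conv
        by (rule cotangent_linear[OF p U(1) x])
      also have "\<dots> = (\<Sum>b\<in>Basis. snd (\<psi> z) \<bullet> b * v ((\<lambda>x. \<phi> x \<bullet> b) \<circ> fst))"
        unfolding w_def inner_sum_left inner_scaleR_left pushforward_def
        by (intro sum.cong refl) (simp add: inner_commute[of _ "snd (\<psi> z)"])
      also have "\<dots> = (\<Sum>a\<leftarrow>L. fst a z * v (snd a))"
        unfolding L_def bs(1)[symmetric] sum_list_distinct_conv_sum_set[OF bs(2), symmetric]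
        by (simp add: o_def)
      finally show "liouville_form z v = (\<Sum>a\<leftarrow>L. fst a z * v (snd a))" .
    qed
    then show "\<exists>L. C.total.form_on V liouville_form L" by blast
  qed
qed

end

section \<open>Dissipation\<close>

context smooth_atlas
begin

lemma smooth_one_formE:
  assumes "smooth_one_form \<omega>" "(U, \<phi>) \<in> A"
  obtains L where "form_on U \<omega> L"
  using assms unfolding smooth_one_form_def by blast

lemma form_on_extended:
  assumes \<eta>: "form_on U \<eta> L" and U: "(U, \<phi>) \<in> A" and h: "smooth_function (times_line A) h"
  shows "smooth_atlas.form_on (times_line A) (U \<times> UNIV)
    (\<lambda>x v. pullback fst \<eta> x v + h x * differential snd x v)
    (map (\<lambda>a. (fst a \<circ> fst, snd a \<circ> fst)) L @ [(h, snd)])"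
proof -
  interpret T: fibration A "times_line A" by (rule fibration_times_line)
  have p: "y \<in> points (times_line A)" if "y \<in> U \<times> UNIV" for y
    using that U by (rule T.total.points_chartI[OF times_line_chartI, rotated])
  show ?thesis
    by (intro T.total.form_on_append T.total.form_on_mult_differential
        T.form_on_pullback[OF \<eta> times_line_chartI[OF U] fibred_times_line_chart[OF U]])
      (use h p smooth_near_snd in \<open>auto simp: smooth_function_def\<close>)
qed

lemma smooth_form_differential_minus_pullback:
  assumes \<omega>: "smooth_one_form \<omega>"
  shows "smooth_atlas.smooth_one_form (times_line A) (\<lambda>x v. differential snd x v - pullback fst \<omega> x v)"
proof -
  interpret T: fibration A "times_line A" by (rule fibration_times_line)
  show ?thesis
    unfolding T.total.smooth_one_form_def
  proof clarify
    fix V \<psi> assume V: "(V, \<psi>) \<in> times_line A"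
    obtain U \<phi> where U: "(U, \<phi>) \<in> A" "V = U \<times> UNIV" "\<psi> = map_prod \<phi> id"
      using V by (rule times_line_chartE)
    obtain L where L: "form_on U \<omega> L" using smooth_one_formE[OF \<omega> U(1)] .
    have c: "fibred_chart (U, \<phi>) (V, \<psi>)" unfolding U(2,3) by (rule fibred_times_line_chart[OF U(1)])
    have "T.total.form_on V (\<lambda>x v. 1 * differential snd x v) [(\<lambda>y. 1, snd)]"
      using T.total.points_chartI[OF V] smooth_near_snd
      by (intro T.total.form_on_mult_differential T.total.smooth_near_const) auto
    from T.total.form_on_append[OF this T.total.form_on_uminus[OF T.form_on_pullback[OF L V c]]]
    show "\<exists>L. T.total.form_on V (\<lambda>x v. differential snd x v - pullback fst \<omega> x v) L"
      unfolding mult_1_left diff_conv_add_uminus by blast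
  qed
qed

text \<open>The computation for a 1-form \<open>\<eta>\<close> on the first factor of a product with
  the line. \<open>r\<close> stands for \<open>R(h)\<close> and is tied to \<open>h\<close> through
  \<open>ham\<close> and \<open>X\<eta>\<close>; keeping it abstract separates the argument from the
  construction of the phase space.\<close>

lemma extended_noether_dissipation:
  fixes \<eta> :: "'m one_form" and h :: "'m \<times> real \<Rightarrow> real"
    and X Y :: "('m \<times> real) vector_field"
  defines "\<eta>E \<equiv> \<lambda>x v. pullback fst \<eta> x v + h x * differential snd x v"
    and "W \<equiv> \<lambda>x f. X x f + line_field (times_line A) x f"
  assumes \<eta>: "smooth_one_form \<eta>" and h: "smooth_function (times_line A) h"
    and X: "smooth_vector_field (times_line A) X" and Y: "smooth_vector_field (times_line A) Y"
    and Xt [rule_format]: "\<forall>x\<in>points (times_line A). X x snd = 0"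
    and ham [rule_format]: "\<forall>t. \<forall>y\<in>points A. \<forall>Z. smooth_vector_field A Z \<longrightarrow>
      exterior_derivative A \<eta> (slice_field t X) Z y = Z y (\<lambda>y. h (y, t)) - r (y, t) * \<eta> y (Z y)"
    and X\<eta> [rule_format]: "\<forall>t. \<forall>y\<in>points A. \<eta> y (slice_field t X y) = - h (y, t)"
    and noether [rule_format]: "\<forall>Z. smooth_vector_field (times_line A) Z \<longrightarrow> (\<forall>x\<in>points (times_line A).
      lie_one_form (times_line A) Y \<eta>E Z x = l x * interior_product Z \<eta>E x)"
    and x: "x \<in> points (times_line A)"
  shows "smooth_near (times_line A) (interior_product Y \<eta>E) x"
    and "W x (interior_product Y \<eta>E) = - r x * interior_product Y \<eta>E x"
    and "W x \<in> tangent_space (times_line A) x"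
proof -
  interpret T: fibration A "times_line A" by (rule fibration_times_line)
  have W: "smooth_vector_field (times_line A) W"
    unfolding W_def by (rule T.total.smooth_vector_field_add[OF X smooth_line_field])
  show Wx: "W x \<in> tangent_space (times_line A) x" by (rule T.total.smooth_vector_fieldD(1)[OF W x])
  obtain y t where xyt: "x = (y, t)" by (cases x)
  have y: "y \<in> points A" using x unfolding xyt points_times_line by simp
  obtain U \<phi> where U: "(U, \<phi>) \<in> A" "y \<in> U" using points_chartE[OF y] .
  define V where "V = U \<times> (UNIV :: real set)"
  define \<psi> where "\<psi> = map_prod \<phi> (id :: real \<Rightarrow> real)"
  have V: "(V, \<psi>) \<in> times_line A" "x \<in> V"
    unfolding V_def \<psi>_def xyt using times_line_chartI[OF U(1)] U(2) by auto
  obtain L where L: "form_on U \<eta> L" using smooth_one_formE[OF \<eta> U(1)] .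
  have LE: "T.total.form_on V \<eta>E (map (\<lambda>a. (fst a \<circ> fst, snd a \<circ> fst)) L @ [(h, snd)])"
    unfolding V_def \<eta>E_def by (rule form_on_extended[OF L U(1) h])
  show "smooth_near (times_line A) (interior_product Y \<eta>E) x"
    by (rule T.total.smooth_one_form_interior_product(1)[OF LE V Y])
  \<comment> \<open>The added field along the line kills every \<open>f \<circ> fst\<close>, so
    \<open>W\<close> and \<open>X\<close> have the same slices.\<close>
  have slice: "slice_field s W z = slice_field s X z" for s z
    by (simp add: slice_field_def pushforward_def W_def line_field_fst)
  have Wfst: "W x (g \<circ> fst) = slice_field t X y g" for g
    using fun_cong[OF slice, of t y g] by (simp add: slice_field_def pushforward_def xyt)
  have Yfst: "Y x (g \<circ> fst) = slice_field t Y y g" for g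
    by (simp add: slice_field_def pushforward_def xyt)
  have Wsnd: "W z snd = 1" if "z \<in> points (times_line A)" for z
    using Xt[OF that] line_field_snd[OF that] by (simp add: W_def)
  have W\<eta>E: "interior_product W \<eta>E z = 0" if z: "z \<in> points (times_line A)" for z
  proof -
    obtain y s where zys: "z = (y, s)" by (cases z)
    then have "y \<in> points A" using z unfolding points_times_line by simp
    from X\<eta>[OF this, of s] show ?thesis
      using Wsnd[OF z] slice[of s y]
      by (simp add: interior_product_def \<eta>E_def pullback_def differential_def slice_field_def zys)
  qed
  have YW: "Y x (interior_product W \<eta>E) = 0"
  proof -
    note Yx = T.total.smooth_vector_fieldD(1)[OF Y x]
    have "Y x (interior_product W \<eta>E) = Y x (\<lambda>z. 0)"
      by (rule T.total.tangent_cong[OF Yx V W\<eta>E[OF T.total.points_chartI[OF V(1)]]])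
    then show ?thesis using T.total.tangent_const[OF Yx] by simp
  qed
  have "interior_product (lie_bracket (times_line A) Y W) \<eta>E x = 0"
    using noether[OF W x] YW W\<eta>E[OF x] by (simp add: lie_one_form_def lie_function_def)
  moreover have "T.total.smooth_one_form \<eta>E"
    unfolding T.total.smooth_one_form_def
  proof clarify
    fix V' \<psi>' assume "(V', \<psi>') \<in> times_line A"
    then obtain U' \<phi>' where U': "(U', \<phi>') \<in> A" "V' = U' \<times> UNIV" by (rule times_line_chartE)
    obtain L' where "form_on U' \<eta> L'" using smooth_one_formE[OF \<eta> U'(1)] .
    from form_on_extended[OF this U'(1) h] show "\<exists>L. T.total.form_on V' \<eta>E L"
      unfolding U'(2) \<eta>E_def by (rule exI)
  qed
  ultimately have "interior_product (lie_bracket (times_line A) W Y) \<eta>E x = 0"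
    using T.total.interior_product_lie_bracket_antisym[OF _ x W Y] by simp
  then have "W x (interior_product Y \<eta>E) = exterior_derivative (times_line A) \<eta>E W Y x"
    using YW by (simp add: exterior_derivative_def lie_function_def)
  \<comment> \<open>The pulled-back pairs only see the slices of \<open>W\<close> and
    \<open>Y\<close>; the appended pair \<open>(h, snd)\<close> contributes the last
    bracket.\<close>
  also have "\<dots> = (\<Sum>a\<leftarrow>L. slice_field t X y (fst a) * slice_field t Y y (snd a)
        - slice_field t Y y (fst a) * slice_field t X y (snd a))
      + (W x h * Y x snd - Y x h * W x snd)"
    unfolding T.total.exterior_derivative_form_on[OF LE V W Y]
    by (simp add: o_def[of _ "\<lambda>a. (fst a \<circ> fst, snd a \<circ> fst)"] Wfst Yfst)
  also have "(\<Sum>a\<leftarrow>L. slice_field t X y (fst a) * slice_field t Y y (snd a)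
        - slice_field t Y y (fst a) * slice_field t X y (snd a)) =
      exterior_derivative A \<eta> (slice_field t X) (slice_field t Y) y"
    by (rule exterior_derivative_form_on[OF L U smooth_slice_field[OF X] smooth_slice_field[OF Y], symmetric])
  also have "\<dots> = slice_field t Y y (\<lambda>y. h (y, t)) - r x * \<eta> y (slice_field t Y y)"
    unfolding xyt by (rule ham[OF y smooth_slice_field[OF Y]])
  finally have 1: "W x (interior_product Y \<eta>E) =
    slice_field t Y y (\<lambda>y. h (y, t)) - r x * \<eta> y (slice_field t Y y) + (W x h * Y x snd - Y x h * W x snd)" .
  have hx: "smooth_near (times_line A) h (y, t)" using h x unfolding smooth_function_def xyt by blast
  have Yh: "Y x h = slice_field t Y y (\<lambda>y. h (y, t)) + Y x snd * line_field (times_line A) x h"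
    using tangent_times_line_split[OF T.total.smooth_vector_fieldD(1)[OF Y x, unfolded xyt] hx]
    by (simp add: slice_field_def xyt)
  have Xh: "X x h = slice_field t X y (\<lambda>y. h (y, t))"
    using tangent_times_line_split[OF T.total.smooth_vector_fieldD(1)[OF X x, unfolded xyt] hx] Xt[OF x]
    by (simp add: slice_field_def xyt)
  \<comment> \<open>Testing the equation of \<open>X\<close> on its own slice makes the left side
    vanish and determines the derivative of \<open>h\<close> along \<open>X\<close>.\<close>
  have "exterior_derivative A \<eta> (slice_field t X) (slice_field t X) y = 0"
    unfolding exterior_derivative_form_on[OF L U smooth_slice_field[OF X] smooth_slice_field[OF X]]
    by simp
  then have "slice_field t X y (\<lambda>y. h (y, t)) = - r x * h x"
    using ham[OF y smooth_slice_field[OF X], of t] X\<eta>[OF y, of t] by (simp add: xyt)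
  then have Wh: "W x h = - r x * h x + line_field (times_line A) x h"
    using Xh by (simp add: W_def)
  have "interior_product Y \<eta>E x = \<eta> y (slice_field t Y y) + h x * Y x snd"
    by (simp add: interior_product_def \<eta>E_def pullback_def differential_def slice_field_def xyt)
  \<comment> \<open>With \<open>W x snd = 1\<close>, the slice derivative of \<open>h\<close> along
    \<open>Y\<close> occurs once with each sign, as does \<open>Y x snd\<close> times the time
    derivative of \<open>h\<close>.\<close>
  then show "W x (interior_product Y \<eta>E) = - r x * interior_product Y \<eta>E x"
    unfolding 1 Yh Wh Wsnd[OF x] by (simp add: algebra_simps)
qed

end

theorem theorem3:
  fixes T :: "'q topology"
    and A :: "('q, 'e::euclidean_space) atlas"
    and h :: "'q extended_point \<Rightarrow> real"
    and X Y :: "'q extended_point vector_field"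
  assumes "smooth_manifold T A"
    and "smooth_function (extended_phase_space A) h"
    and "contact_hamiltonian_vector_field A h X"
    and "generalized_noether_symmetry A h Y"
  shows "dissipated_quantity A h X (\<lambda>x. - interior_product Y (extended_contact_form h) x)"
proof -
  interpret Q: smooth_atlas A by (rule smooth_manifold_smooth_atlas[OF assms(1)])
  interpret C: smooth_atlas "cotangent_bundle A" by (rule Q.smooth_atlas_cotangent_bundle)
  interpret N: smooth_atlas "contact_phase_space A" by (rule C.smooth_atlas_times_line)
  interpret M: smooth_atlas "extended_phase_space A" by (rule N.smooth_atlas_times_line)
  have \<eta>E: "extended_contact_form h = (\<lambda>x v. pullback fst contact_form x v + h x * differential snd x v)"
    by (intro ext) (rule extended_contact_form_def)
  have "N.smooth_one_form (\<lambda>x v. differential snd x v - pullback fst liouville_form x v)"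
    by (rule C.smooth_form_differential_minus_pullback[OF Q.smooth_liouville_form])
  moreover have "(contact_form :: 'q contact_point one_form) = (\<lambda>x v. differential snd x v - pullback fst liouville_form x v)"
    by (intro ext) (rule contact_form_def)
  ultimately have \<eta>: "N.smooth_one_form contact_form" by simp
  have X: "smooth_vector_field (extended_phase_space A) X"
    using assms(3) unfolding contact_hamiltonian_vector_field_def by blast
  have Xt: "\<forall>x\<in>points (extended_phase_space A). X x snd = 0"
    using assms(3) unfolding contact_hamiltonian_vector_field_def differential_def by blast
  have ham: "\<forall>t. \<forall>y\<in>points (contact_phase_space A). \<forall>Z. smooth_vector_field (contact_phase_space A) Z \<longrightarrow>
      exterior_derivative (contact_phase_space A) contact_form (slice_field t X) Z y =
      Z y (\<lambda>y. h (y, t)) - reeb_derivative A h (y, t) * contact_form y (Z y)"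
    using assms(3)
    unfolding contact_hamiltonian_vector_field_def differential_def interior_product_def reeb_derivative_def
    by simp
  have X\<eta>: "\<forall>t. \<forall>y\<in>points (contact_phase_space A). contact_form y (slice_field t X y) = - h (y, t)"
    using assms(3) unfolding contact_hamiltonian_vector_field_def interior_product_def by blast
  obtain l where Y: "smooth_vector_field (extended_phase_space A) Y"
    and noether: "\<forall>Z. smooth_vector_field (extended_phase_space A) Z \<longrightarrow>
      (\<forall>x\<in>points (extended_phase_space A).
        lie_one_form (extended_phase_space A) Y (extended_contact_form h) Z x =
          l x * interior_product Z (extended_contact_form h) x)"
    using assms(4) unfolding generalized_noether_symmetry_def by blast
  \<comment> \<open>The factor that carries \<open>\<eta>\<close> is the contact phase space, with
    \<open>contact_form\<close> for \<open>\<eta>\<close> and \<open>reeb_derivative A h\<close> for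
    \<open>r\<close>.\<close>
  note main = N.extended_noether_dissipation[OF \<eta> assms(2) X Y Xt ham X\<eta> noether[unfolded \<eta>E],
      folded \<eta>E]
  show ?thesis
    unfolding dissipated_quantity_def smooth_function_def lie_function_def
  proof (intro conjI ballI)
    fix x assume x: "x \<in> points (extended_phase_space A)"
    show "smooth_near (extended_phase_space A) (\<lambda>x. - interior_product Y (extended_contact_form h) x) x"
      by (rule M.smooth_near_uminus[OF main(1)[OF x]])
    show "time_dependent_field A X x (\<lambda>x. - interior_product Y (extended_contact_form h) x) =
        - reeb_derivative A h x * - interior_product Y (extended_contact_form h) x"
      \<comment> \<open>Pulling the sign out of the operator requires it to be tangent and its
        argument to be smooth near \<open>x\<close>.\<close>
      using M.tangent_uminus[OF main(3)[OF x] main(1)[OF x]] main(2)[OF x]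
      by (simp add: time_dependent_field_def)
  qed
qed

end
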